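(* Let $A$ be a monotone complete C*-algebra and $M\subseteq N$ Hilbert $A$-modules with $M^\perp_N=\{0\}$. Then the self-dual Hilbert $A$-module $M'$ admits an isometric $A$-linear embedding as a Hilbert $A$-submodule of the self-dual Hilbert $A$-module $N'$ which extends the given isometric embedding $M\subseteq N\subseteq N'$ (in the same way as $M$ is embedded in $M'$ via $x\mapsto\langle x,\cdot\rangle$), and the embedded copy of $M'$ is an orthogonal direct summand of $N'$.
   Context: A monotone complete C*-algebra is a unital C*-algebra in which every norm-bounded increasing net of self-adjoint elements has a least upper bound in the self-adjoint part. For a Hilbert $A$-module $M$, its $A$-dual $M'$ is the module of all bounded $A$-linear maps $M\to A$ (with $(r\cdot a)(x)=a^*r(x)$); when $A$ is monotone complete, the inner product of $M$ extends to an $A$-valued inner product on $M'$ making $M'$ a self-dual Hilbert $A$-module (every bounded $A$-linear map $M'\to A$ is given by $\langle r,\cdot\rangle$), with $M\subseteq M'$ via $x\mapsto\langle x,\cdot\rangle$ and $r(x)=\langle r,x\rangle$ for $x\in M$, $r\in M'$. $M^\perp_N=\{y\in N:\langle x,y\rangle=0\ \forall x\in M\}$. *)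

theory Defs
  imports Complex_Main
begin

definition cstar_alg :: "(complex \<Rightarrow> 'a::{real_normed_algebra_1,banach} \<Rightarrow> 'a) \<Rightarrow> ('a \<Rightarrow> 'a) \<Rightarrow> bool" where
  "cstar_alg scC st \<longleftrightarrow>
     (\<forall>c d x. scC (c + d) x = scC c x + scC d x) \<and>
     (\<forall>c x y. scC c (x + y) = scC c x + scC c y) \<and>
     (\<forall>c d x. scC (c * d) x = scC c (scC d x)) \<and>
     (\<forall>r x. scC (complex_of_real r) x = scaleR r x) \<and>
     (\<forall>c x. norm (scC c x) = cmod c * norm x) \<and>
     (\<forall>c x y. scC c (x * y) = scC c x * y \<and> scC c (x * y) = x * scC c y) \<and>
     (\<forall>x y. st (x + y) = st x + st y) \<and>
     (\<forall>c x. st (scC c x) = scC (cnj c) (st x)) \<and>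
     (\<forall>x y. st (x * y) = st y * st x) \<and>
     (\<forall>x. st (st x) = x) \<and>
     (\<forall>x. norm (st x * x) = (norm x)^2)"

definition cpos :: "('a::ring \<Rightarrow> 'a) \<Rightarrow> 'a \<Rightarrow> bool" where
  "cpos st a \<longleftrightarrow> (\<exists>x. a = st x * x)"

definition csa :: "('a \<Rightarrow> 'a) \<Rightarrow> 'a \<Rightarrow> bool" where
  "csa st a \<longleftrightarrow> st a = a"

definition cle :: "('a::ring \<Rightarrow> 'a) \<Rightarrow> 'a \<Rightarrow> 'a \<Rightarrow> bool" where
  "cle st a b \<longleftrightarrow> cpos st (b - a)"

text \<open>Monotone completeness: every norm-bounded increasing net of self-adjoint elements
has a least upper bound in the self-adjoint part. The ranges of increasing nets are
exactly the nonempty upward-directed sets, so we quantify over those.\<close>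

definition monotone_complete :: "(complex \<Rightarrow> 'a::{real_normed_algebra_1,banach} \<Rightarrow> 'a) \<Rightarrow> ('a \<Rightarrow> 'a) \<Rightarrow> bool" where
  "monotone_complete scC st \<longleftrightarrow> cstar_alg scC st \<and>
     (\<forall>S. S \<noteq> {} \<and> S \<subseteq> {a. csa st a} \<and> (\<exists>B. \<forall>s\<in>S. norm s \<le> B) \<and>
          (\<forall>x\<in>S. \<forall>y\<in>S. \<exists>w\<in>S. cle st x w \<and> cle st y w) \<longrightarrow>
          (\<exists>u. csa st u \<and> (\<forall>s\<in>S. cle st s u) \<and>
               (\<forall>v. csa st v \<and> (\<forall>s\<in>S. cle st s v) \<longrightarrow> cle st u v)))"

definition mnorm :: "('m \<Rightarrow> 'm \<Rightarrow> 'a::real_normed_vector) \<Rightarrow> 'm \<Rightarrow> real" where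
  "mnorm ip x = sqrt (norm (ip x x))"

definition hilbert_mod ::
  "(complex \<Rightarrow> 'a::{real_normed_algebra_1,banach} \<Rightarrow> 'a) \<Rightarrow> ('a \<Rightarrow> 'a) \<Rightarrow>
   'm set \<Rightarrow> ('m \<Rightarrow> 'm \<Rightarrow> 'm) \<Rightarrow> 'm \<Rightarrow> (complex \<Rightarrow> 'm \<Rightarrow> 'm) \<Rightarrow> ('m \<Rightarrow> 'a \<Rightarrow> 'm) \<Rightarrow>
   ('m \<Rightarrow> 'm \<Rightarrow> 'a) \<Rightarrow> bool" where
  "hilbert_mod scC st X add z sc rm ip \<longleftrightarrow>
     z \<in> X \<and>
     (\<forall>x\<in>X. \<forall>y\<in>X. add x y \<in> X) \<and>
     (\<forall>c. \<forall>x\<in>X. sc c x \<in> X) \<and>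
     (\<forall>x\<in>X. \<forall>a. rm x a \<in> X) \<and>
     (\<forall>x\<in>X. \<forall>y\<in>X. \<forall>w\<in>X. add (add x y) w = add x (add y w)) \<and>
     (\<forall>x\<in>X. \<forall>y\<in>X. add x y = add y x) \<and>
     (\<forall>x\<in>X. add x z = x) \<and>
     (\<forall>x\<in>X. add x (sc (-1) x) = z) \<and>
     (\<forall>c d. \<forall>x\<in>X. sc (c + d) x = add (sc c x) (sc d x)) \<and>
     (\<forall>c. \<forall>x\<in>X. \<forall>y\<in>X. sc c (add x y) = add (sc c x) (sc c y)) \<and>
     (\<forall>c d. \<forall>x\<in>X. sc (c * d) x = sc c (sc d x)) \<and>
     (\<forall>x\<in>X. sc 1 x = x) \<and>
     (\<forall>x\<in>X. \<forall>y\<in>X. \<forall>a. rm (add x y) a = add (rm x a) (rm y a)) \<and>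
     (\<forall>x\<in>X. \<forall>a b. rm x (a + b) = add (rm x a) (rm x b)) \<and>
     (\<forall>x\<in>X. \<forall>a b. rm x (a * b) = rm (rm x a) b) \<and>
     (\<forall>x\<in>X. rm x 1 = x) \<and>
     (\<forall>c. \<forall>x\<in>X. \<forall>a. sc c (rm x a) = rm (sc c x) a \<and> rm x (scC c a) = sc c (rm x a)) \<and>
     (\<forall>x\<in>X. \<forall>y\<in>X. \<forall>w\<in>X. ip x (add y w) = ip x y + ip x w) \<and>
     (\<forall>c. \<forall>x\<in>X. \<forall>y\<in>X. ip x (sc c y) = scC c (ip x y)) \<and>
     (\<forall>x\<in>X. \<forall>y\<in>X. \<forall>a. ip x (rm y a) = ip x y * a) \<and>
     (\<forall>x\<in>X. \<forall>y\<in>X. st (ip x y) = ip y x) \<and>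
     (\<forall>x\<in>X. cpos st (ip x x)) \<and>
     (\<forall>x\<in>X. ip x x = 0 \<longrightarrow> x = z) \<and>
     (\<forall>f::nat \<Rightarrow> 'm. (\<forall>n. f n \<in> X) \<and>
        (\<forall>e>0. \<exists>K. \<forall>m n. K \<le> m \<and> K \<le> n \<longrightarrow> mnorm ip (add (f m) (sc (-1) (f n))) < e) \<longrightarrow>
        (\<exists>l\<in>X. (\<lambda>n. mnorm ip (add (f n) (sc (-1) l))) \<longlonglongrightarrow> 0))"

definition bdd_alin ::
  "(complex \<Rightarrow> 'a::{real_normed_algebra_1,banach} \<Rightarrow> 'a) \<Rightarrow>
   'm set \<Rightarrow> ('m \<Rightarrow> 'm \<Rightarrow> 'm) \<Rightarrow> (complex \<Rightarrow> 'm \<Rightarrow> 'm) \<Rightarrow> ('m \<Rightarrow> 'a \<Rightarrow> 'm) \<Rightarrow>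
   ('m \<Rightarrow> 'm \<Rightarrow> 'a) \<Rightarrow> ('m \<Rightarrow> 'a) \<Rightarrow> bool" where
  "bdd_alin scC X add sc rm ip r \<longleftrightarrow>
     (\<forall>x\<in>X. \<forall>y\<in>X. r (add x y) = r x + r y) \<and>
     (\<forall>c. \<forall>x\<in>X. r (sc c x) = scC c (r x)) \<and>
     (\<forall>x\<in>X. \<forall>a. r (rm x a) = r x * a) \<and>
     (\<exists>K. \<forall>x\<in>X. norm (r x) \<le> K * mnorm ip x)"

definition adual ::
  "(complex \<Rightarrow> 'a::{real_normed_algebra_1,banach} \<Rightarrow> 'a) \<Rightarrow>
   'm set \<Rightarrow> ('m \<Rightarrow> 'm \<Rightarrow> 'm) \<Rightarrow> (complex \<Rightarrow> 'm \<Rightarrow> 'm) \<Rightarrow> ('m \<Rightarrow> 'a \<Rightarrow> 'm) \<Rightarrow>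
   ('m \<Rightarrow> 'm \<Rightarrow> 'a) \<Rightarrow> ('m \<Rightarrow> 'a) set" where
  "adual scC X add sc rm ip = {r. bdd_alin scC X add sc rm ip r \<and> (\<forall>x. x \<notin> X \<longrightarrow> r x = 0)}"

definition dadd :: "('m \<Rightarrow> 'a::plus) \<Rightarrow> ('m \<Rightarrow> 'a) \<Rightarrow> 'm \<Rightarrow> 'a" where
  "dadd r s = (\<lambda>x. r x + s x)"

definition dzero :: "'m \<Rightarrow> 'a::zero" where
  "dzero = (\<lambda>x. 0)"

definition dsc :: "(complex \<Rightarrow> 'a \<Rightarrow> 'a) \<Rightarrow> complex \<Rightarrow> ('m \<Rightarrow> 'a) \<Rightarrow> 'm \<Rightarrow> 'a" where
  "dsc scC c r = (\<lambda>x. scC (cnj c) (r x))"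

definition drm :: "('a \<Rightarrow> 'a) \<Rightarrow> ('m \<Rightarrow> 'a::times) \<Rightarrow> 'a \<Rightarrow> 'm \<Rightarrow> 'a" where
  "drm st r a = (\<lambda>x. st a * r x)"

definition hat :: "'m set \<Rightarrow> ('m \<Rightarrow> 'm \<Rightarrow> 'a::zero) \<Rightarrow> 'm \<Rightarrow> 'm \<Rightarrow> 'a" where
  "hat X ip x = (\<lambda>y. if y \<in> X then ip x y else 0)"

definition dual_inner ::
  "(complex \<Rightarrow> 'a::{real_normed_algebra_1,banach} \<Rightarrow> 'a) \<Rightarrow> ('a \<Rightarrow> 'a) \<Rightarrow>
   'm set \<Rightarrow> ('m \<Rightarrow> 'm \<Rightarrow> 'm) \<Rightarrow> (complex \<Rightarrow> 'm \<Rightarrow> 'm) \<Rightarrow> ('m \<Rightarrow> 'a \<Rightarrow> 'm) \<Rightarrow>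
   ('m \<Rightarrow> 'm \<Rightarrow> 'a) \<Rightarrow> (('m \<Rightarrow> 'a) \<Rightarrow> ('m \<Rightarrow> 'a) \<Rightarrow> 'a) \<Rightarrow> bool" where
  "dual_inner scC st X add sc rm ip ip' \<longleftrightarrow>
     (let D = adual scC X add sc rm ip in
       hilbert_mod scC st D dadd dzero (dsc scC) (drm st) ip' \<and>
       (\<forall>x\<in>X. \<forall>y\<in>X. ip' (hat X ip x) (hat X ip y) = ip x y) \<and>
       (\<forall>r\<in>D. \<forall>x\<in>X. ip' r (hat X ip x) = r x) \<and>
       (\<forall>\<phi>. bdd_alin scC D dadd (dsc scC) (drm st) ip' \<phi> \<longrightarrow>
          (\<exists>r\<in>D. \<forall>s\<in>D. \<phi> s = ip' r s)))"

end

theory Submission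
  imports Defs "HOL-Analysis.Urysohn"
begin

text \<open>The restriction map \<open>\<rho> : N' \<rightarrow> M'\<close> has closed graph: norm convergence in either dual implies
  convergence at every point of the module. It is therefore bounded, so for \<open>r \<in> M'\<close> the functional
  \<open>\<langle>r, \<rho>(\<cdot>)\<rangle>\<close> on the self-dual module \<open>N'\<close> is represented by some \<open>\<Phi> r \<in> N'\<close>; that is,
  \<open>\<Phi> = \<rho>\<^sup>*\<close>. Evaluation at \<open>x \<in> M\<close> gives \<open>\<rho> \<Phi> = id\<close>, hence \<open>\<langle>\<Phi> r, \<Phi> s\<rangle> = \<langle>r, \<rho> \<Phi> s\<rangle> = \<langle>r, s\<rangle>\<close>,
  and \<open>\<Phi> \<rho>\<close> is the orthogonal projection of \<open>N'\<close> onto the image of \<open>\<Phi>\<close>. The norm estimates rest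
  on the Cauchy--Schwarz inequality and so on the positivity of \<open>x\<^sup>*x\<close> in a C*-algebra; the latter
  needs no spectral theory once positivity of a self-adjoint \<open>a\<close> is read as \<open>\<parallel>t - a\<parallel> \<le> t\<close> for some \<open>t\<close>.\<close>

section \<open>Positivity in C*-algebras\<close>

locale cstar_algebra =
  fixes scC :: "complex \<Rightarrow> 'a::{real_normed_algebra_1,banach} \<Rightarrow> 'a" and st :: "'a \<Rightarrow> 'a"
  assumes cstar: "cstar_alg scC st"
begin

section \<open>Scalars, involution and self-adjoint elements\<close>

lemma scC_add_right: "scC c (x + y) = scC c x + scC c y"
  and scC_scC: "scC c (scC d x) = scC (c * d) x"
  and scC_of_real: "scC (complex_of_real r) x = r *\<^sub>R x"
  and norm_scC: "norm (scC c x) = cmod c * norm x"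
  and scC_mult_left: "scC c x * y = scC c (x * y)"
  and scC_mult_right: "x * scC c y = scC c (x * y)"
  and star_add: "st (x + y) = st x + st y"
  and star_scC: "st (scC c x) = scC (cnj c) (st x)"
  and star_mult: "st (x * y) = st y * st x"
  and star_star [simp]: "st (st x) = x"
  and norm_star_mult: "norm (st x * x) = (norm x)\<^sup>2"
  using cstar unfolding cstar_alg_def by metis+

lemma scC_minus_one: "scC (-1) x = - x"
  using scC_of_real[of "-1" x] by simp

lemma scC_minus_right: "scC c (- x) = - scC c x"
  using scC_scC[of "-1" c x] scC_scC[of c "-1" x] by (simp add: scC_minus_one)

lemma scC_minus_left: "scC (- c) x = - scC c x"
  using scC_scC[of "-1" c x] by (simp add: scC_minus_one)

lemma scC_diff_right: "scC c (x - y) = scC c x - scC c y"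
  using scC_add_right[of c x "- y"] by (simp add: scC_minus_right)

lemma scC_one: "scC 1 x = x"
  using scC_of_real[of 1 x] by simp

lemma scC_zero_left: "scC 0 x = 0"
  using scC_of_real[of 0 x] by simp

lemma scC_zero_right: "scC c 0 = 0"
  using norm_scC[of c 0] by simp

lemma star_zero [simp]: "st 0 = 0"
  using star_add[of 0 0] by simp

lemma star_minus: "st (- x) = - st x"
  using star_add[of x "- x"] by (simp add: eq_neg_iff_add_eq_0 add.commute)

lemma star_diff: "st (x - y) = st x - st y"
  using star_add[of x "- y"] by (simp add: star_minus)

lemma star_scaleR: "st (r *\<^sub>R x) = r *\<^sub>R st x"
  using star_scC[of "complex_of_real r" x] by (simp add: scC_of_real)

lemma star_one [simp]: "st 1 = 1"
  using star_mult[of "st 1" 1] by simp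

text \<open>The C*-identity and submultiplicativity give one inequality; applied to
  \<open>st x\<close> it becomes the other.\<close>

lemma norm_star [simp]: "norm (st x) = norm x"
proof -
  have le: "norm x \<le> norm (st x)" for x
  proof (cases "x = 0")
    case False
    have "(norm x)\<^sup>2 \<le> norm (st x) * norm x"
      using norm_mult_ineq[of "st x" x] by (simp add: norm_star_mult)
    then show ?thesis
      using False by (simp add: power2_eq_square)
  qed simp
  show ?thesis
    using le[of x] le[of "st x"] by simp
qed

lemma bounded_linear_star: "bounded_linear st"
  by (rule bounded_linear_intro[where K = 1]) (simp_all add: star_add star_scaleR)

lemma closed_csa: "closed {a. csa st a}"
proof -
  have "continuous_on UNIV st"
    by (rule linear_continuous_on[OF bounded_linear_star])
  then show ?thesis
    unfolding csa_def by (intro closed_Collect_eq) auto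
qed

lemma norm_square_csa: "csa st b \<Longrightarrow> norm (b * b) = (norm b)\<^sup>2"
  using norm_star_mult[of b] by (simp add: csa_def)

text \<open>With commuting self-adjoint \<open>b\<close> and \<open>w\<close>, the element \<open>b + \<i>w\<close> is a multiple of a unitary, and
  \<open>b\<close> is its real part.\<close>

lemma norm_le_of_commuting_squares:
  assumes b: "csa st b" and w: "csa st w" and comm: "b * w = w * b"
    and eq: "b * b + w * w = r *\<^sub>R 1" and r: "0 \<le> r"
  shows "(norm b)\<^sup>2 \<le> r"
proof -
  define u where "u = b + scC \<i> w"
  have stu: "st u = b - scC \<i> w"
    using b w scC_scC[of "-1" \<i> w]
    by (simp add: u_def star_add star_scC csa_def scC_minus_one)
  \<comment> \<open>The cross terms cancel because \<open>b\<close> and \<open>w\<close>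
    commute.\<close>
  have "st u * u = b * b + w * w"
    unfolding stu
    by (simp add: u_def algebra_simps scC_mult_left scC_mult_right scC_add_right scC_diff_right
        scC_scC comm scC_minus_one)
  then have u: "(norm u)\<^sup>2 = r"
    using norm_star_mult[of u] r by (simp add: eq)
  have "2 *\<^sub>R b = u + st u"
    unfolding stu by (simp add: u_def scaleR_2)
  then have "2 * norm b \<le> norm u + norm (st u)"
    by (metis norm_scaleR norm_triangle_ineq abs_numeral)
  then have "norm b \<le> norm u"
    by simp
  then show ?thesis
    using u by (metis norm_ge_zero power_mono)
qed

section \<open>Square roots of shifted self-adjoint elements\<close>

text \<open>The square root of \<open>1 - h\<close> is \<open>1 - y\<close> for a fixed point \<open>y\<close> of \<open>y \<mapsto> (h + y\<^sup>2) / 2\<close>. The iteration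
  started at \<open>0\<close> is dominated by the increasing bounded scalar iteration for \<open>h = 1\<close>.\<close>

lemma sqrt_one_minus:
  assumes h: "csa st h" and nh: "norm h \<le> 1"
  obtains w where "csa st w" "w * w = 1 - h" "norm (1 - w) \<le> 1"
    "\<And>c. c * h = h * c \<Longrightarrow> c * w = w * c"
proof -
  define F where "F = (\<lambda>y::'a. (1/2) *\<^sub>R (h + y * y))"
  define f where "f = (\<lambda>t::real. (1 + t * t) / 2)"
  define Y where "Y n = (F ^^ n) 0" for n
  define e where "e n = (f ^^ n) 0" for n
  have Y0: "Y 0 = 0" and YS: "Y (Suc n) = F (Y n)" for n
    by (simp_all add: Y_def)
  have e0: "e 0 = 0" and eS: "e (Suc n) = f (e n)" for n
    by (simp_all add: e_def)
  have e_bds: "0 \<le> e n \<and> e n \<le> 1" for n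
  proof (induction n)
    case (Suc n)
    then have "e n * e n \<le> 1"
      by (simp add: mult_le_one)
    with Suc show ?case
      by (simp add: eS f_def)
  qed (simp add: e0)
  have e_mono: "e n \<le> e (Suc n)" for n
    using zero_le_square[of "1 - e n"] by (simp add: eS f_def algebra_simps)
  have Ye: "norm (Y n) \<le> e n" for n
  proof (induction n)
    case (Suc n)
    have "norm (Y n * Y n) \<le> e n * e n"
      using norm_mult_ineq[of "Y n" "Y n"] Suc mult_mono[OF Suc Suc] e_bds[of n]
      by simp
    then have "norm (h + Y n * Y n) \<le> 1 + e n * e n"
      using norm_triangle_ineq[of h "Y n * Y n"] nh by linarith
    then show ?case
      by (simp add: YS F_def eS f_def)
  qed (simp add: Y0 e0)
  have dYe: "norm (Y (Suc n) - Y n) \<le> e (Suc n) - e n" for n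
  proof (induction n)
    case 0
    then show ?case
      using nh by (simp add: Y0 e0 YS eS F_def f_def)
  next
    case (Suc n)
    let ?d = "Y (Suc n) - Y n"
    \<comment> \<open>The noncommutative difference of squares,
      \<open>a * a - b * b = (a - b) * a + b * (a - b)\<close>.\<close>
    have "Y (Suc (Suc n)) - Y (Suc n) = (1/2) *\<^sub>R (?d * Y (Suc n) + Y n * ?d)"
      by (simp add: YS[of "Suc n"]  F_def YS[of n] algebra_simps flip: scaleR_add_right)
         (simp add: algebra_simps)
    moreover have "norm (?d * Y (Suc n)) \<le> (e (Suc n) - e n) * e (Suc n)"
      using norm_mult_ineq[of ?d "Y (Suc n)"] mult_mono[OF Suc Ye[of "Suc n"]] e_mono[of n]
      by simp
    moreover have "norm (Y n * ?d) \<le> e n * (e (Suc n) - e n)"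
      using norm_mult_ineq[of "Y n" ?d] mult_mono[OF Ye[of n] Suc] e_bds[of n]
      by simp
    ultimately have "norm (Y (Suc (Suc n)) - Y (Suc n))
        \<le> ((e (Suc n) - e n) * e (Suc n) + e n * (e (Suc n) - e n)) / 2"
      using norm_triangle_ineq[of "?d * Y (Suc n)" "Y n * ?d"] by simp
    also have "\<dots> = e (Suc (Suc n)) - e (Suc n)"
      unfolding eS[of "Suc n"] f_def using eS[of n] unfolding f_def
      by (simp add: field_simps)
    finally show ?case .
  qed
  \<comment> \<open>The scalar increments telescope to a convergent series, which dominates the
    increments of \<open>Y\<close>.\<close>
  have "incseq e"
    using e_mono by (simp add: incseq_SucI)
  then have "convergent e"
    using e_bds incseq_convergent[of e 1] by (metis convergentI)
  then have "summable (\<lambda>n. e (Suc n) - e n)"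
    by (auto simp: convergent_def dest: telescope_sums sums_summable)
  then have "summable (\<lambda>n. Y (Suc n) - Y n)"
    by (rule summable_comparison_test'[where N = 0]) (use dYe in simp)
  then obtain l where "(\<lambda>n. \<Sum>k<n. Y (Suc k) - Y k) \<longlonglongrightarrow> l"
    by (auto simp: summable_def sums_def)
  then have Yl: "Y \<longlonglongrightarrow> l"
    by (simp add: sum_lessThan_telescope Y0)
  have fixed: "F l = l"
  proof (rule LIMSEQ_unique)
    show "(\<lambda>n. F (Y n)) \<longlonglongrightarrow> F l"
      unfolding F_def by (intro tendsto_intros Yl)
    show "(\<lambda>n. F (Y n)) \<longlonglongrightarrow> l"
      using LIMSEQ_Suc[OF Yl] by (simp add: YS)
  qed
  show ?thesis
  proof (rule that[of "1 - l"])
    have "csa st (Y n)" for n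
      by (induction n)
         (use h in \<open>simp_all add: csa_def Y0 YS F_def star_scaleR star_add star_mult\<close>)
    then have "csa st l"
      using closed_sequentially[OF closed_csa _ Yl] by simp
    then show "csa st (1 - l)"
      by (simp add: csa_def star_diff)
    have "l + l = 2 *\<^sub>R F l"
      using fixed by (simp add: scaleR_2)
    also have "\<dots> = h + l * l"
      by (simp add: F_def)
    finally show "(1 - l) * (1 - l) = 1 - h"
      by (simp add: algebra_simps)
    have "norm (Y n) \<le> 1" for n
      using Ye[of n] e_bds[of n] by linarith
    then show "norm (1 - (1 - l)) \<le> 1"
      using Lim_bounded[OF tendsto_norm[OF Yl], of 0 1] by simp
  next
    fix c
    assume c: "c * h = h * c"
    \<comment> \<open>Each iterate is a polynomial in \<open>h\<close>, so it commutes with whatever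
      commutes with \<open>h\<close>; the limit inherits this.\<close>
    have cY: "c * Y n = Y n * c" for n
    proof (induction n)
      case (Suc n)
      have "c * (Y n * Y n) = Y n * Y n * c"
        by (metis Suc mult.assoc)
      then show ?case
        by (simp add: YS F_def c distrib_left distrib_right)
    qed (simp add: Y0)
    have "(\<lambda>n. c * Y n) \<longlonglongrightarrow> c * l" "(\<lambda>n. Y n * c) \<longlonglongrightarrow> l * c"
      by (intro tendsto_intros Yl)+
    then have "c * l = l * c"
      by (simp add: cY LIMSEQ_unique)
    then show "c * (1 - l) = (1 - l) * c"
      by (simp add: algebra_simps)
  qed
qed

text \<open>Rescaling of the case \<open>t = 1\<close>: the root for \<open>h / t\<close> is
  multiplied by \<open>sqrt t\<close>. If \<open>t = 0\<close>, then \<open>h = 0\<close>.\<close>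

lemma sqrt_diff:
  assumes h: "csa st h" and nh: "norm h \<le> t"
  obtains w where "csa st w" "w * w = t *\<^sub>R 1 - h" "norm (sqrt t *\<^sub>R 1 - w) \<le> sqrt t"
    "\<And>c. c * h = h * c \<Longrightarrow> c * w = w * c"
proof (cases "t = 0")
  case True
  then show ?thesis
    using that[of 0] nh by (simp add: csa_def)
next
  case False
  then have t: "0 < t"
    using nh norm_ge_zero[of h] by linarith
  define g where "g = (1/t) *\<^sub>R h"
  have "csa st g" "norm g \<le> 1"
    using h nh t by (simp_all add: g_def csa_def star_scaleR)
  then obtain w where w: "csa st w" "w * w = 1 - g" "norm (1 - w) \<le> 1"
    and wc: "\<And>c. c * g = g * c \<Longrightarrow> c * w = w * c"
    using sqrt_one_minus by metis
  show ?thesis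
  proof (rule that[of "sqrt t *\<^sub>R w"])
    show "csa st (sqrt t *\<^sub>R w)"
      using w(1) by (simp add: csa_def star_scaleR)
    have "sqrt t *\<^sub>R w * sqrt t *\<^sub>R w = t *\<^sub>R (w * w)"
      using t by simp
    then show "sqrt t *\<^sub>R w * sqrt t *\<^sub>R w = t *\<^sub>R 1 - h"
      using t by (simp add: w(2) g_def scaleR_diff_right)
    have "norm (sqrt t *\<^sub>R (1 - w)) \<le> sqrt t"
      using w(3) t by (simp add: mult_left_le)
    then show "norm (sqrt t *\<^sub>R 1 - sqrt t *\<^sub>R w) \<le> sqrt t"
      by (simp add: scaleR_diff_right)
    show "c * sqrt t *\<^sub>R w = sqrt t *\<^sub>R w * c" if "c * h = h * c" for c
      using wc[of c] that by (simp add: g_def)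
  qed
qed

section \<open>The cone of positive elements\<close>

text \<open>For self-adjoint \<open>a\<close> this norm condition says that the spectrum of \<open>a\<close> is nonnegative; in this form
  the elements evidently form a convex cone.\<close>

definition norm_pos :: "'a \<Rightarrow> bool" where
  "norm_pos a \<longleftrightarrow> csa st a \<and> (\<exists>t. norm (t *\<^sub>R 1 - a) \<le> t)"

lemma norm_pos_add:
  assumes "norm_pos a" "norm_pos b"
  shows "norm_pos (a + b)"
proof -
  obtain s t where "norm (s *\<^sub>R 1 - a) \<le> s" "norm (t *\<^sub>R 1 - b) \<le> t"
    using assms by (auto simp: norm_pos_def)
  then have "norm ((s *\<^sub>R 1 - a) + (t *\<^sub>R 1 - b)) \<le> s + t"
    using norm_triangle_ineq[of "s *\<^sub>R 1 - a" "t *\<^sub>R 1 - b"] by linarith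
  then have "norm ((s + t) *\<^sub>R 1 - (a + b)) \<le> s + t"
    by (simp add: algebra_simps)
  then show ?thesis
    using assms by (auto simp: norm_pos_def csa_def star_add)
qed

text \<open>Since \<open>a = t - (t - a)\<close>, the root comes from \<open>sqrt_diff\<close> for
  \<open>t - a\<close>. The bound on \<open>sqrt t - w\<close> obtained there is exactly what makes
  \<open>w\<close> satisfy \<open>norm_pos\<close>.\<close>

lemma norm_pos_sqrt:
  assumes "norm_pos a"
  obtains w where "csa st w" "norm_pos w" "w * w = a" "\<And>c. c * a = a * c \<Longrightarrow> c * w = w * c"
proof -
  obtain t where t: "norm (t *\<^sub>R 1 - a) \<le> t" and a: "csa st a"
    using assms by (auto simp: norm_pos_def)
  have h: "csa st (t *\<^sub>R 1 - a)"
    using a by (simp add: csa_def star_diff star_scaleR)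
  obtain w where w: "csa st w" "w * w = t *\<^sub>R 1 - (t *\<^sub>R 1 - a)" "norm (sqrt t *\<^sub>R 1 - w) \<le> sqrt t"
    "\<And>c. c * (t *\<^sub>R 1 - a) = (t *\<^sub>R 1 - a) * c \<Longrightarrow> c * w = w * c"
    using sqrt_diff[OF h t] by metis
  show ?thesis
  proof (rule that[of w])
    show "norm_pos w"
      using w(1,3) by (auto simp: norm_pos_def)
    show "c * w = w * c" if "c * a = a * c" for c
      using w(4)[of c] that by (simp add: algebra_simps)
  qed (use w(1,2) in simp_all)
qed

lemma norm_pos_square:
  assumes b: "csa st b"
  shows "norm_pos (b * b)"
proof -
  define t where "t = (norm b)\<^sup>2"
  have bb: "csa st (b * b)"
    using b by (simp add: csa_def star_mult)
  have "norm (b * b) \<le> t"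
    by (simp add: t_def norm_square_csa[OF b])
  then obtain w where w: "csa st w" "w * w = t *\<^sub>R 1 - b * b" "b * w = w * b"
    using sqrt_diff[OF bb] by (metis mult.assoc)
  have "(norm w)\<^sup>2 \<le> t"
    by (rule norm_le_of_commuting_squares[of w b]) (use w b in \<open>simp_all add: t_def\<close>)
  then have "norm (t *\<^sub>R 1 - b * b) \<le> t"
    using norm_square_csa[OF w(1)] w(2) by simp
  then show ?thesis
    using bb by (auto simp: norm_pos_def)
qed

lemma norm_pos_norm_diff:
  assumes h: "csa st h" and "norm h \<le> t"
  shows "norm_pos (t *\<^sub>R 1 - h)"
proof -
  obtain w where "csa st w" "w * w = t *\<^sub>R 1 - h"
    using sqrt_diff[OF assms] by metis
  then show ?thesis
    using norm_pos_square by metis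
qed

text \<open>Commuting roots of \<open>a\<close> and \<open>- a\<close> have squares with sum zero,
  so both vanish.\<close>

lemma norm_pos_antisym:
  assumes "norm_pos a" "norm_pos (- a)"
  shows "a = 0"
proof -
  obtain b where b: "csa st b" "b * b = a"
    using norm_pos_sqrt[OF assms(1)] by metis
  obtain w where w: "csa st w" "w * w = - a" "\<And>c. c * - a = - a * c \<Longrightarrow> c * w = w * c"
    using norm_pos_sqrt[OF assms(2)] by metis
  have "b * w = w * b"
    by (rule w(3)) (simp add: b(2)[symmetric] mult.assoc)
  then have "(norm b)\<^sup>2 \<le> 0"
    by (intro norm_le_of_commuting_squares[of b w]) (use b w(1,2) in simp_all)
  then show ?thesis
    using b(2) by simp
qed

text \<open>With \<open>r\<close> the norm of \<open>p + q\<close>, both \<open>p\<close> and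
  \<open>r - p\<close> are squares of commuting self-adjoint elements, so the root of
  \<open>p\<close> has norm at most \<open>sqrt r\<close>.\<close>

lemma norm_pos_norm_mono:
  assumes p: "norm_pos p" and q: "norm_pos q"
  shows "norm p \<le> norm (p + q)"
proof -
  define r where "r = norm (p + q)"
  obtain b where b: "csa st b" "b * b = p"
    using norm_pos_sqrt[OF p] by metis
  have "norm_pos (r *\<^sub>R 1 - (p + q))"
    by (rule norm_pos_norm_diff) (use p q in \<open>simp_all add: norm_pos_def csa_def star_add r_def\<close>)
  then have "norm_pos (r *\<^sub>R 1 - p)"
    using norm_pos_add[OF _ q, of "r *\<^sub>R 1 - (p + q)"] by simp
  then obtain w where w: "csa st w" "w * w = r *\<^sub>R 1 - p"
    "\<And>c. c * (r *\<^sub>R 1 - p) = (r *\<^sub>R 1 - p) * c \<Longrightarrow> c * w = w * c"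
    using norm_pos_sqrt by metis
  have "b * w = w * b"
    by (rule w(3)) (simp add: b(2)[symmetric] algebra_simps)
  then have "(norm b)\<^sup>2 \<le> r"
    by (intro norm_le_of_commuting_squares[of b w]) (use b w(1,2) in \<open>simp_all add: r_def\<close>)
  then show ?thesis
    using norm_square_csa[OF b(1)] b(2) by (simp add: r_def)
qed

section \<open>Spectral radius estimates and positivity of x*x\<close>

lemma norm_power_csa:
  assumes "csa st a"
  shows "norm (a ^ (2 ^ k)) = norm a ^ (2 ^ k)"
proof (induction k)
  case (Suc k)
  have "st (a ^ n) = a ^ n" for n
    using assms by (induction n) (simp_all add: csa_def star_mult power_commutes)
  then have "norm (a ^ (2 ^ k) * a ^ (2 ^ k)) = (norm (a ^ (2 ^ k)))\<^sup>2"
    by (simp add: norm_square_csa csa_def)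
  then show ?case
    by (simp add: Suc power_mult[symmetric] mult.commute flip: power_add mult_2)
qed simp

text \<open>Exponential growth beats linear growth, even along exponents that are powers of
  two.\<close>

lemma power_two_power_bounded_imp_le_one:
  fixes q K :: real
  assumes bd: "\<And>k. q ^ (2 ^ k) \<le> 1 + 2 ^ k * K" and K: "0 \<le> K"
  shows "q \<le> 1"
proof (rule ccontr)
  assume "\<not> q \<le> 1"
  define d where "d = q - 1"
  then have d: "0 < d"
    using \<open>\<not> q \<le> 1\<close> by simp
  have "real k * d\<^sup>2 \<le> 1 + 2 * K" for k
  proof -
    define m where "m = (2::nat) ^ k"
    have m: "1 \<le> real m" "real k \<le> real m"
      using less_exp[of k] unfolding m_def by (simp_all del: of_nat_power)
    have "1 + real m * d \<le> q ^ m"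
      using Bernoulli_inequality[of d m] d by (simp add: d_def)
    then have "real m * d \<le> q ^ m"
      by linarith
    moreover have "0 \<le> real m * d"
      using d by simp
    \<comment> \<open>Bernoulli alone grows only linearly in \<open>m\<close>; squaring it gives
      quadratic growth at exponent \<open>2 * m\<close>, against a bound linear in
      \<open>m\<close>.\<close>
    ultimately have "(real m * d) * (real m * d) \<le> q ^ m * q ^ m"
      by (intro mult_mono) linarith+
    also have "\<dots> \<le> 1 + 2 * real m * K"
      using bd[of "Suc k"] by (simp add: m_def flip: power_add mult_2)
    also have "\<dots> \<le> real m * (1 + 2 * K)"
      using m by (simp add: algebra_simps)
    finally have "real m * (real m * d\<^sup>2) \<le> real m * (1 + 2 * K)"
      by (simp add: power2_eq_square mult_ac)
    then have "real m * d\<^sup>2 \<le> 1 + 2 * K"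
      using m by (subst (asm) mult_le_cancel_left_pos) auto
    moreover have "real k * d\<^sup>2 \<le> real m * d\<^sup>2"
      using m by (intro mult_right_mono) auto
    ultimately show ?thesis
      by linarith
  qed
  moreover obtain k where "1 + 2 * K < real k * d\<^sup>2"
    using reals_Archimedean3[of "d\<^sup>2"] d by auto
  ultimately show False
    by (metis not_less)
qed

text \<open>This is the coincidence of the spectra of \<open>y\<^sup>*y\<close> and \<open>yy\<^sup>*\<close> away from \<open>0\<close>. For \<open>S = t + y\<^sup>*y\<close> and
  \<open>T = t + yy\<^sup>*\<close>, the relation \<open>Ty = yS\<close> gives \<open>\<parallel>T\<^sup>n\<parallel> = O(n t\<^sup>n)\<close>, and \<open>\<parallel>T\<parallel>\<close> is
  the spectral radius of \<open>T\<close>.\<close>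

lemma norm_pos_flip:
  assumes "norm_pos (- (st y * y))"
  shows "norm_pos (- (y * st y))"
proof (cases "y = 0")
  case True
  then show ?thesis
    using assms by simp
next
  case False
  obtain t where t: "norm (t *\<^sub>R 1 + st y * y) \<le> t"
    using assms by (auto simp: norm_pos_def)
  define S where "S = t *\<^sub>R 1 + st y * y"
  define T where "T = t *\<^sub>R 1 + y * st y"
  have T: "csa st T"
    by (simp add: T_def csa_def star_add star_scaleR star_mult)
  have "0 \<le> t"
    using t norm_ge_zero order_trans by blast
  moreover have "t \<noteq> 0"
    using t False norm_star_mult[of y] by auto
  ultimately have t0: "0 < t"
    by simp
  define K where "K = (norm y)\<^sup>2 / t"
  have TyS: "T ^ n * y = y * S ^ n" for n
  proof (induction n)
    case (Suc n)
    have "T ^ Suc n * y = T * (y * S ^ n)"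
      by (simp add: Suc mult.assoc)
    also have "\<dots> = y * S ^ Suc n"
      by (simp add: T_def S_def algebra_simps)
    finally show ?case .
  qed simp
  have bound: "norm (T ^ n) \<le> t ^ n * (1 + real n * K)" for n
  proof (induction n)
    case (Suc n)
    have "T ^ Suc n = T ^ n * T"
      by (rule power_Suc2)
    \<comment> \<open>Intertwining turns the second summand into one controlled by powers of
      \<open>S\<close>, so each step adds at most \<open>t ^ n\<close> times the square of
      \<open>norm y\<close>.\<close>
    also have "\<dots> = t *\<^sub>R T ^ n + (T ^ n * y) * st y"
      by (simp add: T_def algebra_simps)
    also have "\<dots> = t *\<^sub>R T ^ n + y * S ^ n * st y"
      by (simp add: TyS)
    finally have "norm (T ^ Suc n) \<le> norm (t *\<^sub>R T ^ n) + norm (y * S ^ n * st y)"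
      by (metis norm_triangle_ineq)
    moreover have "norm (t *\<^sub>R T ^ n) \<le> t * (t ^ n * (1 + real n * K))"
      using Suc t0 by simp
    moreover have "norm (y * S ^ n * st y) \<le> (norm y * t ^ n) * norm y"
    proof -
      have "norm (S ^ n) \<le> t ^ n"
        using norm_power_ineq[of S n] power_mono[OF t[folded S_def], of n] by simp
      then have "norm (y * S ^ n) \<le> norm y * t ^ n"
        by (intro order_trans[OF norm_mult_ineq] mult_left_mono) auto
      then show ?thesis
        by (intro order_trans[OF norm_mult_ineq]) (simp add: mult_right_mono)
    qed
    moreover have "(norm y * t ^ n) * norm y = t ^ Suc n * K"
      using t0 by (simp add: K_def power2_eq_square)
    moreover have "t ^ Suc n * (1 + real (Suc n) * K) = t * (t ^ n * (1 + real n * K)) + t ^ Suc n * K"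
      by (simp add: algebra_simps)
    ultimately show ?case
      by linarith
  qed simp
  have "norm T / t \<le> 1"
  proof (rule power_two_power_bounded_imp_le_one)
    show "(norm T / t) ^ 2 ^ k \<le> 1 + 2 ^ k * K" for k
      using bound[of "2 ^ k"] t0
      by (simp add: norm_power_csa[OF T] power_divide divide_le_eq mult.commute)
    show "0 \<le> K"
      using t0 by (simp add: K_def)
  qed
  then have "norm (t *\<^sub>R 1 - - (y * st y)) \<le> t"
    using t0 by (simp add: T_def)
  then show ?thesis
    by (auto simp: norm_pos_def csa_def star_minus star_mult)
qed

text \<open>Kaplansky's theorem. With \<open>a = x\<^sup>*x\<close> and \<open>c = (\<bar>a\<bar> - a) / 2\<close> the negative part of \<open>a\<close>, the element
  \<open>y = xc\<close> satisfies \<open>y\<^sup>*y = - c\<^sup>3 \<le> 0\<close>, hence also \<open>yy\<^sup>* \<le> 0\<close>; but \<open>y\<^sup>*y + yy\<^sup>*\<close> is twice the sum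
  of the squares of the real and imaginary parts of \<open>y\<close>.\<close>

lemma norm_pos_star_mult: "norm_pos (st x * x)"
proof -
  define a where "a = st x * x"
  have a: "csa st a"
    by (simp add: a_def csa_def star_mult)
  obtain p where p: "csa st p" "norm_pos p" "p * p = a * a" "a * p = p * a"
    using norm_pos_sqrt[OF norm_pos_square[OF a]] by (metis mult.assoc)
  obtain q where q: "csa st q" "q * q = p" "\<And>d. d * p = p * d \<Longrightarrow> d * q = q * d"
    using norm_pos_sqrt[OF p(2)] by metis
  define c where "c = (1/2) *\<^sub>R (p - a)"
  have c: "csa st c"
    using a p by (simp add: c_def csa_def star_scaleR star_diff)
  \<comment> \<open>Here \<open>p\<close> is the absolute value of \<open>a\<close>; the identities
    express that the positive part \<open>(p + a) / 2\<close> annihilates \<open>c\<close>.\<close>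
  have cc: "c * c = - (a * c)" and pc: "p * c = c * c" and cp: "c * p = p * c"
    using p(3,4) by (simp_all add: c_def algebra_simps flip: scaleR_add_left)
  have cq: "c * q = q * c"
    by (rule q(3)[OF cp])
  define y where "y = x * c"
  have "st y * y = c * (a * c)"
    using c by (simp add: y_def star_mult a_def csa_def mult.assoc)
  also have "\<dots> = - (c * (c * c))"
    by (simp add: cc)
  \<comment> \<open>The root \<open>q\<close> of \<open>p\<close> exhibits the cube of
    \<open>c\<close>, equal to \<open>c * p * c\<close>, as the square of the self-adjoint element
    \<open>q * c\<close>.\<close>
  also have "c * (c * c) = (q * c) * (q * c)"
    by (metis pc cp cq q(2) mult.assoc)
  finally have yy: "- (st y * y) = (q * c) * (q * c)"
    by simp
  have "csa st (q * c)"
    using c q(1) cq by (simp add: csa_def star_mult)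
  then have neg: "norm_pos (- (st y * y))"
    unfolding yy by (rule norm_pos_square)
  then have neg': "norm_pos (- (y * st y))"
    by (rule norm_pos_flip)
  define u where "u = y + st y"
  define v where "v = scC \<i> (y - st y)"
  have "csa st u"
    by (simp add: u_def csa_def star_add add.commute)
  moreover have "csa st v"
    by (simp add: v_def csa_def star_scC star_diff scC_minus_left scC_diff_right)
  moreover have "u * u + v * v = 2 *\<^sub>R (st y * y) + 2 *\<^sub>R (y * st y)"
    unfolding v_def scC_mult_left scC_mult_right scC_scC
    by (simp add: u_def scC_minus_one scaleR_2 algebra_simps)
  ultimately have sum: "norm_pos (2 *\<^sub>R (st y * y) + 2 *\<^sub>R (y * st y))"
    by (metis norm_pos_add norm_pos_square)
  \<comment> \<open>Adding two copies of \<open>- (y * st y)\<close> and one of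
    \<open>- (st y * y)\<close> leaves \<open>st y * y\<close>, which is thus positive together with
    its negative.\<close>
  have "norm_pos (2 *\<^sub>R (st y * y) + 2 *\<^sub>R (y * st y)
      + (- (y * st y) + - (y * st y)) + - (st y * y))"
    by (intro norm_pos_add[OF norm_pos_add[OF sum norm_pos_add]] neg neg')
  then have "norm_pos (st y * y)"
    by (simp add: scaleR_2)
  then have "st y * y = 0"
    using norm_pos_antisym neg by blast
  then have "(q * c) * (q * c) = 0"
    using yy by simp
  then have "c * (c * c) = 0"
    using \<open>c * (c * c) = (q * c) * (q * c)\<close> by simp
  \<comment> \<open>A vanishing fourth power forces \<open>c = 0\<close> by two uses of the
    C*-identity.\<close>
  then have "(c * c) * (c * c) = 0"
    by (simp add: mult.assoc)
  then have "norm c = 0"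
    using norm_square_csa[of "c * c"] norm_square_csa[OF c] c
    by (simp add: csa_def star_mult)
  then have "a = p"
    by (simp add: c_def)
  then show ?thesis
    using p(2) by (simp add: a_def)
qed

lemma cpos_imp_norm_pos: "cpos st a \<Longrightarrow> norm_pos a"
  by (auto simp: cpos_def norm_pos_star_mult)

end

section \<open>Hilbert modules\<close>

locale hilbert_module = cstar_algebra scC st
  for scC :: "complex \<Rightarrow> 'a::{real_normed_algebra_1,banach} \<Rightarrow> 'a" and st :: "'a \<Rightarrow> 'a" +
  fixes X :: "'m set" and add :: "'m \<Rightarrow> 'm \<Rightarrow> 'm" and z :: 'm
    and sc :: "complex \<Rightarrow> 'm \<Rightarrow> 'm" and rm :: "'m \<Rightarrow> 'a \<Rightarrow> 'm" and ip :: "'m \<Rightarrow> 'm \<Rightarrow> 'a"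
  assumes hilbert_mod: "hilbert_mod scC st X add z sc rm ip"
begin

section \<open>Inner product calculus\<close>

lemma zero_closed: "z \<in> X"
  and add_closed: "\<lbrakk>x \<in> X; y \<in> X\<rbrakk> \<Longrightarrow> add x y \<in> X"
  and sc_closed: "x \<in> X \<Longrightarrow> sc c x \<in> X"
  and rm_closed: "x \<in> X \<Longrightarrow> rm x a \<in> X"
  using hilbert_mod unfolding hilbert_mod_def by simp_all

lemma add_assoc: "\<lbrakk>x \<in> X; y \<in> X; w \<in> X\<rbrakk> \<Longrightarrow> add (add x y) w = add x (add y w)"
  and add_commute: "\<lbrakk>x \<in> X; y \<in> X\<rbrakk> \<Longrightarrow> add x y = add y x"
  and add_zero_right: "x \<in> X \<Longrightarrow> add x z = x"
  and add_neg_right: "x \<in> X \<Longrightarrow> add x (sc (-1) x) = z"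
  using hilbert_mod unfolding hilbert_mod_def by metis+

lemma ip_add_right: "\<lbrakk>x \<in> X; y \<in> X; w \<in> X\<rbrakk> \<Longrightarrow> ip x (add y w) = ip x y + ip x w"
  and ip_sc_right: "\<lbrakk>x \<in> X; y \<in> X\<rbrakk> \<Longrightarrow> ip x (sc c y) = scC c (ip x y)"
  and ip_rm_right: "\<lbrakk>x \<in> X; y \<in> X\<rbrakk> \<Longrightarrow> ip x (rm y a) = ip x y * a"
  and star_ip: "\<lbrakk>x \<in> X; y \<in> X\<rbrakk> \<Longrightarrow> st (ip x y) = ip y x"
  and cpos_ip: "x \<in> X \<Longrightarrow> cpos st (ip x x)"
  and ip_self_eq_0: "\<lbrakk>x \<in> X; ip x x = 0\<rbrakk> \<Longrightarrow> x = z"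
  using hilbert_mod unfolding hilbert_mod_def by simp_all

lemma ip_add_left: "\<lbrakk>x \<in> X; y \<in> X; w \<in> X\<rbrakk> \<Longrightarrow> ip (add x y) w = ip x w + ip y w"
  by (metis add_closed ip_add_right star_add star_ip)

lemma ip_sc_left: "\<lbrakk>x \<in> X; y \<in> X\<rbrakk> \<Longrightarrow> ip (sc c x) y = scC (cnj c) (ip x y)"
  by (metis sc_closed ip_sc_right star_scC star_ip)

lemma ip_rm_left: "\<lbrakk>x \<in> X; y \<in> X\<rbrakk> \<Longrightarrow> ip (rm x a) y = st a * ip x y"
  by (metis rm_closed ip_rm_right star_mult star_ip)

lemma ip_zero_right: "x \<in> X \<Longrightarrow> ip x z = 0"
  using ip_add_right[of x z z] add_zero_right[OF zero_closed] zero_closed by simp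

definition sub :: "'m \<Rightarrow> 'm \<Rightarrow> 'm" where
  "sub x y = add x (sc (-1) y)"

lemma sub_closed: "\<lbrakk>x \<in> X; y \<in> X\<rbrakk> \<Longrightarrow> sub x y \<in> X"
  by (simp add: sub_def add_closed sc_closed)

lemma ip_sub_right: "\<lbrakk>x \<in> X; y \<in> X; w \<in> X\<rbrakk> \<Longrightarrow> ip x (sub y w) = ip x y - ip x w"
  by (simp add: sub_def ip_add_right ip_sc_right sc_closed scC_minus_one)

lemma ip_sub_left: "\<lbrakk>x \<in> X; y \<in> X; w \<in> X\<rbrakk> \<Longrightarrow> ip (sub x y) w = ip x w - ip y w"
  by (simp add: sub_def ip_add_left ip_sc_left sc_closed scC_minus_one)

lemmas closed = zero_closed add_closed sc_closed rm_closed sub_closed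
lemmas ip_simps = ip_add_right ip_sc_right ip_rm_right ip_sub_right ip_zero_right

text \<open>Identities in \<open>X\<close> are verified by pairing with all elements, which turns them into identities in
  the algebra.\<close>

lemma eq_iff_ip:
  assumes x: "x \<in> X" and y: "y \<in> X"
  shows "x = y \<longleftrightarrow> (\<forall>w\<in>X. ip w x = ip w y)"
proof
  assume eq: "\<forall>w\<in>X. ip w x = ip w y"
  have "ip (sub x y) (sub x y) = 0"
    using x y eq by (simp add: closed ip_sub_right)
  then have "sub x y = z"
    using x y by (intro ip_self_eq_0 closed)
  then have "add (sub x y) y = y"
    using y by (simp add: add_commute add_zero_right zero_closed)
  moreover have "add (sub x y) y = add x (add y (sc (-1) y))"
    using x y by (simp add: sub_def add_assoc add_commute[of "sc (-1) y"] sc_closed)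
  then have "add (sub x y) y = x"
    using x y by (simp add: add_neg_right add_zero_right)
  ultimately show "x = y"
    by simp
qed simp

section \<open>The module norm and the Cauchy-Schwarz inequality\<close>

lemma mnorm_nonneg: "0 \<le> mnorm ip x"
  by (simp add: mnorm_def)

lemma mnorm_power2: "(mnorm ip x)\<^sup>2 = norm (ip x x)"
  by (simp add: mnorm_def)

lemma mnorm_eq_0: "x \<in> X \<Longrightarrow> mnorm ip x = 0 \<longleftrightarrow> x = z"
  using ip_self_eq_0[of x] ip_zero_right[OF zero_closed] by (auto simp: mnorm_def)

lemma mnorm_sc: "x \<in> X \<Longrightarrow> mnorm ip (sc c x) = cmod c * mnorm ip x"
  by (simp add: mnorm_def ip_sc_left ip_sc_right closed norm_scC real_sqrt_mult)

text \<open>Positivity of \<open>\<langle>x - y c, x - y c\<rangle>\<close> for \<open>c = k\<^sup>-\<^sup>1 \<langle>y, x\<rangle>\<close> with \<open>k = \<parallel>y\<parallel>\<^sup>2\<close>.\<close>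

lemma norm_ip_le:
  assumes x: "x \<in> X" and y: "y \<in> X"
  shows "norm (ip x y) \<le> mnorm ip x * mnorm ip y"
proof (cases "y = z")
  case True
  then show ?thesis
    using x by (simp add: ip_zero_right mnorm_nonneg)
next
  case False
  define k where "k = norm (ip y y)"
  have k: "0 < k"
    using ip_self_eq_0[OF y] False by (auto simp: k_def)
  define b where "b = ip x y"
  have stb: "st b = ip y x"
    using x y by (simp add: b_def star_ip)
  define c where "c = (1/k) *\<^sub>R st b"
  have stc: "st c = (1/k) *\<^sub>R b"
    by (simp add: c_def star_scaleR)
  define P where "P = ip (sub x (rm y c)) (sub x (rm y c))"
  have P: "P = ip x x - b * c - st c * st b + st c * ip y y * c"
    using x y stb
    by (simp add: P_def ip_sub_left ip_sub_right ip_rm_left ip_rm_right closed b_def algebra_simps)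
  have "norm_pos P"
    using x y by (simp add: P_def cpos_imp_norm_pos cpos_ip closed)
  \<comment> \<open>Adding this positive element replaces \<open>ip y y\<close> inside
    \<open>P\<close> by its norm \<open>k\<close>.\<close>
  moreover have "norm_pos (st c * (k *\<^sub>R 1 - ip y y) * c)"
  proof -
    have "norm_pos (k *\<^sub>R 1 - ip y y)"
      by (rule norm_pos_norm_diff) (use y in \<open>simp_all add: csa_def star_ip k_def\<close>)
    then obtain w where "csa st w" "w * w = k *\<^sub>R 1 - ip y y"
      using norm_pos_sqrt by metis
    then have "st c * (k *\<^sub>R 1 - ip y y) * c = st (w * c) * (w * c)"
      by (simp add: star_mult csa_def mult.assoc flip: \<open>w * w = _\<close>)
    then show ?thesis
      by (simp add: norm_pos_star_mult)
  qed
  ultimately have Q: "norm_pos (P + st c * (k *\<^sub>R 1 - ip y y) * c)"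
    by (rule norm_pos_add)
  have "P + st c * (k *\<^sub>R 1 - ip y y) * c = ip x x - (1/k) *\<^sub>R (b * st b)"
    unfolding P stc using k by (simp add: c_def algebra_simps)
  then have "norm_pos (ip x x - (1/k) *\<^sub>R (b * st b))"
    using Q by simp
  \<comment> \<open>Written in the form \<open>st v * v\<close>, the subtracted term is positive, so
    monotonicity of the norm applies.\<close>
  moreover have "(1/k) *\<^sub>R (b * st b) = st ((1 / sqrt k) *\<^sub>R st b) * ((1 / sqrt k) *\<^sub>R st b)"
    using k by (simp add: star_scaleR)
  ultimately have "norm ((1/k) *\<^sub>R (b * st b))
      \<le> norm ((1/k) *\<^sub>R (b * st b) + (ip x x - (1/k) *\<^sub>R (b * st b)))"
    by (intro norm_pos_norm_mono) (simp_all only: norm_pos_star_mult)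
  then have "norm (b * st b) / k \<le> norm (ip x x)"
    using k by simp
  moreover have "norm (b * st b) = (norm b)\<^sup>2"
    using norm_star_mult[of "st b"] by simp
  ultimately have "(norm b)\<^sup>2 \<le> (mnorm ip x * mnorm ip y)\<^sup>2"
    using k by (simp add: power_mult_distrib mnorm_power2 divide_le_eq k_def)
  then show ?thesis
    unfolding b_def by (rule power2_le_imp_le) (simp add: mnorm_nonneg)
qed

lemma mnorm_add:
  assumes x: "x \<in> X" and y: "y \<in> X"
  shows "mnorm ip (add x y) \<le> mnorm ip x + mnorm ip y"
proof (rule power2_le_imp_le)
  have "(mnorm ip (add x y))\<^sup>2 = norm ((ip x x + ip x y) + (ip y x + ip y y))"
    using x y by (simp add: mnorm_power2 ip_add_left ip_add_right closed algebra_simps)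
  also have "\<dots> \<le> (norm (ip x x) + norm (ip x y)) + (norm (ip y x) + norm (ip y y))"
    by (intro norm_triangle_le add_mono norm_triangle_ineq)
  also have "\<dots> \<le> (mnorm ip x + mnorm ip y)\<^sup>2"
    using norm_ip_le[OF x y] norm_ip_le[OF y x, unfolded mult.commute[of "mnorm ip y"]]
    by (simp add: power2_sum mnorm_power2)
  finally show "(mnorm ip (add x y))\<^sup>2 \<le> (mnorm ip x + mnorm ip y)\<^sup>2" .
qed (simp add: mnorm_nonneg)

lemma mnorm_sub_commute:
  assumes "x \<in> X" "y \<in> X"
  shows "mnorm ip (sub x y) = mnorm ip (sub y x)"
proof -
  have "sub x y = sc (-1) (sub y x)"
    using assms by (subst eq_iff_ip) (simp_all add: closed ip_simps scC_minus_one)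
  then show ?thesis
    using assms by (simp add: mnorm_sc closed)
qed

lemma sub_eq_zero_iff: "\<lbrakk>x \<in> X; y \<in> X\<rbrakk> \<Longrightarrow> sub x y = z \<longleftrightarrow> x = y"
  by (simp add: eq_iff_ip closed ip_simps)

lemma mnorm_sub_triangle:
  assumes "x \<in> X" "y \<in> X" "w \<in> X"
  shows "mnorm ip (sub x w) \<le> mnorm ip (sub x y) + mnorm ip (sub y w)"
proof -
  have "sub x w = add (sub x y) (sub y w)"
    using assms by (subst eq_iff_ip) (simp_all add: closed ip_simps)
  then show ?thesis
    using assms by (simp add: mnorm_add closed)
qed

lemma mnorm_le_sub:
  assumes "x \<in> X" "y \<in> X"
  shows "mnorm ip x \<le> mnorm ip (sub x y) + mnorm ip y"
proof -
  have "x = add (sub x y) y"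
    using assms by (subst eq_iff_ip) (simp_all add: closed ip_simps)
  then show ?thesis
    using assms by (metis mnorm_add sub_closed)
qed

lemma mnorm_sub_le:
  assumes "x \<in> X" "y \<in> X"
  shows "mnorm ip (sub x y) \<le> mnorm ip x + mnorm ip y"
  using assms mnorm_add[of x "sc (-1) y"] by (simp add: sub_def mnorm_sc closed)

section \<open>Completeness and Baire category\<close>

lemma complete:
  assumes "\<And>n. f n \<in> X"
    and "\<And>e. 0 < e \<Longrightarrow> \<exists>K. \<forall>m n. K \<le> m \<and> K \<le> n \<longrightarrow> mnorm ip (sub (f m) (f n)) < e"
  obtains l where "l \<in> X" "(\<lambda>n. mnorm ip (sub (f n) l)) \<longlonglongrightarrow> 0"
proof -
  have "\<forall>f::nat \<Rightarrow> 'm. (\<forall>n. f n \<in> X) \<and>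
      (\<forall>e>0. \<exists>K. \<forall>m n. K \<le> m \<and> K \<le> n \<longrightarrow> mnorm ip (sub (f m) (f n)) < e) \<longrightarrow>
      (\<exists>l\<in>X. (\<lambda>n. mnorm ip (sub (f n) l)) \<longlonglongrightarrow> 0)"
    using hilbert_mod unfolding hilbert_mod_def sub_def by blast
  then show ?thesis
    using assms that by blast
qed

lemma Cauchy_of_geometric:
  assumes f: "\<And>n. f n \<in> X" and step: "\<And>n. mnorm ip (sub (f (Suc n)) (f n)) \<le> C / 2 ^ n"
  shows "m \<le> n \<Longrightarrow> mnorm ip (sub (f n) (f m)) \<le> 2 * C / 2 ^ m"
proof -
  assume "m \<le> n"
  \<comment> \<open>The subtracted tail \<open>2 * C / 2 ^ n\<close> lets the induction close: it
    drops by exactly \<open>C / 2 ^ n\<close> at each step.\<close>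
  then have "mnorm ip (sub (f n) (f m)) \<le> 2 * C / 2 ^ m - 2 * C / 2 ^ n"
  proof (induction n rule: dec_induct)
    case base
    have "sub (f m) (f m) = z"
      using f by (simp add: sub_eq_zero_iff)
    then show ?case
      using mnorm_eq_0[OF zero_closed] by simp
  next
    case (step n)
    then show ?case
      using mnorm_sub_triangle[OF f[of "Suc n"] f[of n] f[of m]] assms(2)[of n] by simp
  qed
  moreover have "0 \<le> C"
    using order_trans[OF mnorm_nonneg step[of 0]] by simp
  ultimately show ?thesis
    by (smt (verit) divide_nonneg_nonneg zero_le_power)
qed

text \<open>In a complete space covered by countably many sets, the closure of one of them contains
  a ball; density in that ball is stated by approximation.\<close>

lemma Baire:
  fixes V :: "nat \<Rightarrow> 'm set"
  assumes cover: "X = (\<Union>n. V n)"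
  obtains n x0 e where "x0 \<in> X" "0 < e"
    "\<And>x d. \<lbrakk>x \<in> X; mnorm ip (sub x x0) < e; 0 < d\<rbrakk> \<Longrightarrow> \<exists>v\<in>V n. mnorm ip (sub x v) < d"
proof -
  \<comment> \<open>\<open>Metric_space\<close> asks for symmetry on the whole type, hence the value
    0 off \<open>X\<close>.\<close>
  define D where "D = (\<lambda>x y. if x \<in> X \<and> y \<in> X then mnorm ip (sub x y) else 0)"
  interpret Metric_space X D
  proof
    show "0 \<le> D x y" for x y
      by (simp add: D_def mnorm_nonneg)
    show "D x y = D y x" for x y
      by (simp add: D_def mnorm_sub_commute)
    show "D x y = 0 \<longleftrightarrow> x = y" if "x \<in> X" "y \<in> X" for x y
      using that by (simp add: D_def mnorm_eq_0 closed sub_eq_zero_iff)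
    show "D x w \<le> D x y + D y w" if "x \<in> X" "y \<in> X" "w \<in> X" for x y w
      using that by (simp add: D_def mnorm_sub_triangle)
  qed
  have compl: mcomplete
    unfolding mcomplete_def
  proof (intro allI impI)
    fix f
    assume "MCauchy f"
    then have f: "\<And>n. f n \<in> X"
      and cau: "\<And>e. 0 < e \<Longrightarrow> \<exists>K. \<forall>m n. K \<le> m \<longrightarrow> K \<le> n \<longrightarrow> D (f m) (f n) < e"
      by (auto simp: MCauchy_def)
    have "\<exists>K. \<forall>m n. K \<le> m \<and> K \<le> n \<longrightarrow> mnorm ip (sub (f m) (f n)) < e" if "0 < e" for e
      using cau[OF that] f unfolding D_def by simp blast
    with f obtain l where l: "l \<in> X" "(\<lambda>n. mnorm ip (sub (f n) l)) \<longlonglongrightarrow> 0"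
      by (rule complete) auto
    have "limitin mtopology f l sequentially"
      unfolding limitin_metric
    proof (intro conjI allI impI l(1))
      fix e :: real
      assume "0 < e"
      then have "\<forall>\<^sub>F n in sequentially. mnorm ip (sub (f n) l) < e"
        by (rule order_tendstoD(2)[OF l(2)])
      then show "\<forall>\<^sub>F n in sequentially. f n \<in> X \<and> D (f n) l < e"
        by (rule eventually_mono) (use f l(1) in \<open>simp add: D_def\<close>)
    qed
    then show "\<exists>l. limitin mtopology f l sequentially" ..
  qed
  have "\<exists>n. mtopology interior_of (mtopology closure_of V n) \<noteq> {}"
  proof (rule ccontr)
    assume "\<not> ?thesis"
    then have "mtopology interior_of \<Union>(range (\<lambda>n. mtopology closure_of V n)) = {}"
      by (intro metric_Baire_category_alt[OF compl]) auto
    moreover have "\<Union>(range (\<lambda>n. mtopology closure_of V n)) = X"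
    proof
      show "\<Union>(range (\<lambda>n. mtopology closure_of V n)) \<subseteq> X"
        using closure_of_subset_topspace[of mtopology] by auto
      have "V n \<subseteq> X" for n
        using cover by blast
      then have "V n \<subseteq> mtopology closure_of V n" for n
        by (simp add: closure_of_subset)
      then show "X \<subseteq> \<Union>(range (\<lambda>n. mtopology closure_of V n))"
        by (subst cover) auto
    qed
    moreover have "mtopology interior_of X = X"
      using interior_of_topspace[of mtopology] by simp
    ultimately show False
      using zero_closed by auto
  qed
  then obtain n x0 where "x0 \<in> mtopology interior_of (mtopology closure_of V n)"
    by blast
  then obtain e where x0: "x0 \<in> X" and e: "0 < e" "mball x0 e \<subseteq> mtopology closure_of V n"
    by (auto simp: metric_interior_of)
  show ?thesis
  proof (rule that[OF x0 e(1)])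
    fix x d
    assume x: "x \<in> X" "mnorm ip (sub x x0) < e" and d: "(0::real) < d"
    have "x \<in> mball x0 e"
      unfolding in_mball using x x0 by (simp add: D_def mnorm_sub_commute)
    then have "x \<in> mtopology closure_of V n"
      using e(2) by blast
    then obtain v where "v \<in> V n" "v \<in> mball x d"
      using d unfolding metric_closure_of by blast
    then show "\<exists>v\<in>V n. mnorm ip (sub x v) < d"
      unfolding in_mball by (auto simp: D_def)
  qed
qed

section \<open>Submodules and the closed graph theorem\<close>

lemma sc_add_left: "x \<in> X \<Longrightarrow> sc (c + d) x = add (sc c x) (sc d x)"
  and sc_add_right: "\<lbrakk>x \<in> X; y \<in> X\<rbrakk> \<Longrightarrow> sc c (add x y) = add (sc c x) (sc c y)"
  and sc_mult: "x \<in> X \<Longrightarrow> sc (c * d) x = sc c (sc d x)"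
  and sc_one: "x \<in> X \<Longrightarrow> sc 1 x = x"
  and rm_add_left: "\<lbrakk>x \<in> X; y \<in> X\<rbrakk> \<Longrightarrow> rm (add x y) a = add (rm x a) (rm y a)"
  and rm_add_right: "x \<in> X \<Longrightarrow> rm x (a + b) = add (rm x a) (rm x b)"
  and rm_mult: "x \<in> X \<Longrightarrow> rm x (a * b) = rm (rm x a) b"
  and rm_one: "x \<in> X \<Longrightarrow> rm x 1 = x"
  and sc_rm: "x \<in> X \<Longrightarrow> sc c (rm x a) = rm (sc c x) a"
  and rm_scC: "x \<in> X \<Longrightarrow> rm x (scC c a) = sc c (rm x a)"
  using hilbert_mod unfolding hilbert_mod_def by metis+

lemmas module_axioms = add_assoc add_commute add_zero_right add_neg_right sc_add_left sc_add_right
  sc_mult sc_one rm_add_left rm_add_right rm_mult rm_one sc_rm rm_scC ip_add_right ip_sc_right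
  ip_rm_right star_ip cpos_ip ip_self_eq_0

text \<open>The equational axioms are universal and pass to subsets, so only closure under the
  operations and completeness remain.\<close>

lemma hilbert_mod_subset:
  assumes S: "S \<subseteq> X" and "z \<in> S"
    and "\<And>x y. \<lbrakk>x \<in> S; y \<in> S\<rbrakk> \<Longrightarrow> add x y \<in> S"
    and "\<And>c x. x \<in> S \<Longrightarrow> sc c x \<in> S"
    and "\<And>x a. x \<in> S \<Longrightarrow> rm x a \<in> S"
    and complete: "\<And>f :: nat \<Rightarrow> 'm. \<lbrakk>\<And>n. f n \<in> S;
      \<And>e. 0 < e \<Longrightarrow> \<exists>K. \<forall>m n. K \<le> m \<and> K \<le> n \<longrightarrow> mnorm ip (sub (f m) (f n)) < e\<rbrakk> \<Longrightarrow>
      \<exists>l\<in>S. (\<lambda>n. mnorm ip (sub (f n) l)) \<longlonglongrightarrow> 0"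
  shows "hilbert_mod scC st S add z sc rm ip"
proof -
  have in_X: "x \<in> S \<Longrightarrow> x \<in> X" for x
    using S by blast
  have cau: "\<forall>f::nat \<Rightarrow> 'm. (\<forall>n. f n \<in> S) \<and>
      (\<forall>e>0. \<exists>K. \<forall>m n. K \<le> m \<and> K \<le> n \<longrightarrow> mnorm ip (add (f m) (sc (-1) (f n))) < e) \<longrightarrow>
      (\<exists>l\<in>S. (\<lambda>n. mnorm ip (add (f n) (sc (-1) l))) \<longlonglongrightarrow> 0)"
    using complete unfolding sub_def by blast
  show ?thesis
    unfolding hilbert_mod_def
    by (intro conjI cau assms(2); intro conjI ballI allI impI;
        (rule assms(3-5) | (rule module_axioms; (rule in_X)?)); assumption)
qed

end

text \<open>By linearity, closedness of the graph need only be tested on null sequences. Baire's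
  theorem gives approximate preimages of bounded image, and successive approximation makes the bound
  exact.\<close>

lemma closed_graph:
  assumes "hilbert_module scC st X addX zX scX rmX ipX"
    and "hilbert_module scC st Y addY zY scY rmY ipY"
    and TY: "\<And>x. x \<in> X \<Longrightarrow> T x \<in> Y"
    and T_add: "\<And>x y. \<lbrakk>x \<in> X; y \<in> X\<rbrakk> \<Longrightarrow> T (addX x y) = addY (T x) (T y)"
    and T_sc: "\<And>c x. x \<in> X \<Longrightarrow> T (scX c x) = scY c (T x)"
    and graph: "\<And>f y. \<lbrakk>\<And>n. f n \<in> X; y \<in> Y; (\<lambda>n. mnorm ipX (f n)) \<longlonglongrightarrow> 0;
      (\<lambda>n. mnorm ipY (addY (T (f n)) (scY (-1) y))) \<longlonglongrightarrow> 0\<rbrakk> \<Longrightarrow> y = zY"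
  obtains K where "0 \<le> K" "\<And>x. x \<in> X \<Longrightarrow> mnorm ipY (T x) \<le> K * mnorm ipX x"
proof -
  interpret X: hilbert_module scC st X addX zX scX rmX ipX by fact
  interpret Y: hilbert_module scC st Y addY zY scY rmY ipY by fact
  have T_sub: "T (X.sub x y) = Y.sub (T x) (T y)" if "x \<in> X" "y \<in> X" for x y
    using that by (simp add: X.sub_def Y.sub_def T_add T_sc X.closed)
  define V where "V n = {x \<in> X. mnorm ipY (T x) \<le> real n}" for n
  have "X = (\<Union>n. V n)"
    using real_arch_simple by (auto simp: V_def)
  then obtain n x0 e where x0: "x0 \<in> X" and e: "0 < e"
    and V: "\<And>x d. \<lbrakk>x \<in> X; mnorm ipX (X.sub x x0) < e; 0 < d\<rbrakk> \<Longrightarrow> \<exists>v\<in>V n. mnorm ipX (X.sub x v) < d"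
    using X.Baire[of V] by metis
  \<comment> \<open>Differences of approximants to \<open>x0 + x\<close> and to \<open>x0\<close>
    move the ball to the origin, at the cost of doubling \<open>n\<close>.\<close>
  have near: "\<exists>w\<in>X. mnorm ipX (X.sub x w) < d \<and> mnorm ipY (T w) \<le> 2 * real n"
    if x: "x \<in> X" "mnorm ipX x < e" and d: "0 < d" for x d
  proof -
    have *: "X.sub (addX x0 x) x0 = x" "X.sub x0 x0 = zX"
      using x x0 by (simp_all add: X.eq_iff_ip X.closed X.ip_simps)
    obtain u where u: "u \<in> V n" "mnorm ipX (X.sub (addX x0 x) u) < d / 2"
      using V[of "addX x0 x" "d/2"] x x0 d by (auto simp: * X.closed)
    obtain v where v: "v \<in> V n" "mnorm ipX (X.sub x0 v) < d / 2"
      using V[of x0 "d/2"] x0 d e X.mnorm_eq_0[OF X.zero_closed] by (auto simp: *)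
    have uv: "u \<in> X" "v \<in> X"
      using u v by (auto simp: V_def)
    have eq: "X.sub x (X.sub u v) = X.sub (X.sub (addX x0 x) u) (X.sub x0 v)"
      using x x0 uv by (subst X.eq_iff_ip) (simp_all add: X.closed X.ip_simps)
    have "mnorm ipX (X.sub x (X.sub u v)) < d"
      unfolding eq using X.mnorm_sub_le[of "X.sub (addX x0 x) u" "X.sub x0 v"] u v x x0 uv
      by (simp add: X.closed)
    moreover have "mnorm ipY (T (X.sub u v)) \<le> 2 * real n"
      using Y.mnorm_sub_le[OF TY TY, OF uv] u v by (simp add: T_sub uv V_def)
    ultimately show ?thesis
      using X.sub_closed[OF uv] by blast
  qed
  define L where "L = 4 * real n / e"
  have L: "0 \<le> L"
    using e by (simp add: L_def)
  have "\<exists>w\<in>X. mnorm ipX (X.sub x w) \<le> mnorm ipX x / 2 \<and> mnorm ipY (T w) \<le> L * mnorm ipX x"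
    if x: "x \<in> X" for x
  proof (cases "x = zX")
    case True
    have "X.sub zX zX = zX" "zX = scX 0 zX"
      by (simp_all add: X.eq_iff_ip X.closed X.ip_simps X.scC_zero_right)
    moreover have "mnorm ipY (T (scX 0 zX)) = 0"
      using TY[OF X.zero_closed] by (simp add: T_sc X.closed Y.mnorm_sc)
    ultimately show ?thesis
      using True X.zero_closed X.mnorm_eq_0[OF X.zero_closed] by (intro bexI[of _ zX]) auto
  next
    case False
    define q where "q = mnorm ipX x"
    have q: "0 < q"
      using False x X.mnorm_eq_0[OF x] X.mnorm_nonneg[of x] unfolding q_def by linarith
    \<comment> \<open>Scaling by \<open>c\<close> brings \<open>x\<close> to norm
      \<open>e / 2\<close>, inside the ball; undoing it turns \<open>2 * n\<close> into
      \<open>L * q\<close>.\<close>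
    define c where "c = e / (2 * q)"
    have c: "0 < c"
      using q e by (simp add: c_def)
    define x' where "x' = scX (complex_of_real c) x"
    have "mnorm ipX x' = e / 2"
      using q e by (simp add: x'_def X.mnorm_sc[OF x] flip: q_def) (simp add: c_def)
    then obtain w where w: "w \<in> X" "mnorm ipX (X.sub x' w) < e / 4" "mnorm ipY (T w) \<le> 2 * real n"
      using near[of x' "e/4"] x e by (auto simp: x'_def X.closed)
    define w' where "w' = scX (complex_of_real (1/c)) w"
    have w': "w' \<in> X"
      by (simp add: w'_def X.closed w)
    have "X.sub x w' = scX (complex_of_real (1/c)) (X.sub x' w)"
      using x w(1) c
      by (subst X.eq_iff_ip)
         (simp_all add: w'_def x'_def X.closed X.ip_simps X.scC_diff_right X.scC_scC X.scC_one)
    then have "mnorm ipX (X.sub x w') = mnorm ipX (X.sub x' w) / c"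
      using c x w(1) by (simp add: X.mnorm_sc X.closed x'_def norm_divide)
    also have "\<dots> \<le> (e / 4) / c"
      using w(2) c by (intro divide_right_mono) auto
    also have "\<dots> = q / 2"
      using e q by (simp add: c_def)
    finally have "mnorm ipX (X.sub x w') \<le> q / 2" .
    moreover have "mnorm ipY (T w') \<le> L * q"
    proof -
      have "mnorm ipY (T w') = mnorm ipY (T w) / c"
        using c w(1) by (simp add: w'_def T_sc Y.mnorm_sc TY norm_divide)
      also have "\<dots> \<le> (2 * real n) / c"
        using w(3) c by (intro divide_right_mono) auto
      also have "\<dots> = L * q"
        by (simp add: L_def c_def)
      finally show ?thesis .
    qed
    ultimately show ?thesis
      using w' by (auto simp: q_def)
  qed
  then obtain W where W: "\<And>x. x \<in> X \<Longrightarrow> W x \<in> X"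
    and W_near: "\<And>x. x \<in> X \<Longrightarrow> mnorm ipX (X.sub x (W x)) \<le> mnorm ipX x / 2"
    and W_bd: "\<And>x. x \<in> X \<Longrightarrow> mnorm ipY (T (W x)) \<le> L * mnorm ipX x"
    by metis
  show ?thesis
  proof (rule that[of "2 * L"])
    show "0 \<le> 2 * L"
      using L by simp
    fix x
    assume x: "x \<in> X"
    \<comment> \<open>\<open>f k\<close> is the remainder of \<open>x\<close> after \<open>k\<close>
      corrections; its norm halves each time.\<close>
    define f where "f k = ((\<lambda>x. X.sub x (W x)) ^^ k) x" for k
    have f0: "f 0 = x" and fS: "f (Suc k) = X.sub (f k) (W (f k))" for k
      by (simp_all add: f_def)
    have f: "f k \<in> X" for k
      by (induction k) (simp_all add: f0 fS x X.closed W)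
    have fn: "mnorm ipX (f k) \<le> mnorm ipX x / 2 ^ k" for k
    proof (induction k)
      case (Suc k)
      then show ?case
        using W_near[OF f[of k]] by (simp add: fS)
    qed (simp add: f0)
    have step: "mnorm ipY (Y.sub (T (f (Suc k))) (T (f k))) \<le> L * mnorm ipX x / 2 ^ k" for k
    proof -
      have "Y.sub (T (f (Suc k))) (T (f k)) = T (X.sub (f (Suc k)) (f k))"
        by (simp add: T_sub f)
      also have "X.sub (f (Suc k)) (f k) = scX (-1) (W (f k))"
        by (subst X.eq_iff_ip) (simp_all add: fS f W X.closed X.ip_simps X.scC_minus_one)
      finally have "mnorm ipY (Y.sub (T (f (Suc k))) (T (f k))) = mnorm ipY (T (W (f k)))"
        by (simp add: T_sc f W Y.mnorm_sc TY)
      also have "\<dots> \<le> L * mnorm ipX (f k)"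
        by (rule W_bd[OF f])
      also have "\<dots> \<le> L * (mnorm ipX x / 2 ^ k)"
        by (rule mult_left_mono[OF fn L])
      finally show ?thesis
        by simp
    qed
    have geo: "m \<le> k \<Longrightarrow> mnorm ipY (Y.sub (T (f k)) (T (f m))) \<le> 2 * (L * mnorm ipX x) / 2 ^ m" for m k
      using Y.Cauchy_of_geometric[of "\<lambda>k. T (f k)", OF TY[OF f] step] .
    have pow0: "(\<lambda>k. C / 2 ^ k) \<longlonglongrightarrow> 0" for C :: real
      by (rule LIMSEQ_divide_realpow_zero) simp
    have "\<exists>K. \<forall>m k. K \<le> m \<and> K \<le> k \<longrightarrow> mnorm ipY (Y.sub (T (f m)) (T (f k))) < d"
      if d: "0 < d" for d
    proof -
      obtain K where K: "\<And>m. K \<le> m \<Longrightarrow> 2 * (L * mnorm ipX x) / 2 ^ m < d"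
        using order_tendstoD(2)[OF pow0 d] by (auto simp: eventually_sequentially)
      have "mnorm ipY (Y.sub (T (f m)) (T (f k))) < d" if "K \<le> m" "K \<le> k" for m k
      proof (cases "k \<le> m")
        case True
        then show ?thesis
          using geo[of k m] K[of k] that by simp
      next
        case False
        then show ?thesis
          using geo[of m k] K[of m] that Y.mnorm_sub_commute[OF TY[OF f] TY[OF f], of m k] by simp
      qed
      then show ?thesis
        by blast
    qed
    then obtain y where y: "y \<in> Y" "(\<lambda>k. mnorm ipY (Y.sub (T (f k)) y)) \<longlonglongrightarrow> 0"
      using Y.complete[of "\<lambda>k. T (f k)"] TY[OF f] by metis
    have "(\<lambda>k. mnorm ipX (f k)) \<longlonglongrightarrow> 0"
      by (rule tendsto_sandwich[OF _ _ tendsto_const pow0[of "mnorm ipX x"]])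
         (simp_all add: fn X.mnorm_nonneg)
    \<comment> \<open>The remainders tend to 0 and their images converge, so the graph condition
      identifies the limit.\<close>
    then have yz: "y = zY"
      using graph[OF f y(1)] y(2) by (simp add: Y.sub_def)
    have "Y.sub w zY = w" if "w \<in> Y" for w
      using that by (simp add: Y.eq_iff_ip Y.closed Y.ip_simps)
    then have "(\<lambda>k. mnorm ipY (T (f k))) \<longlonglongrightarrow> 0"
      using y(2) by (simp add: yz TY f)
    then have lim: "(\<lambda>k. mnorm ipY (T (f k)) + 2 * L * mnorm ipX x) \<longlonglongrightarrow> 0 + 2 * L * mnorm ipX x"
      by (intro tendsto_intros)
    have "mnorm ipY (T x) \<le> mnorm ipY (T (f k)) + 2 * L * mnorm ipX x" for k
      using Y.mnorm_le_sub[OF TY[OF f] TY[OF f], of 0 k] geo[of 0 k]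
        Y.mnorm_sub_commute[OF TY[OF f] TY[OF f], of k 0]
      by (simp add: f0)
    then show "mnorm ipY (T x) \<le> 2 * L * mnorm ipX x"
      using Lim_bounded2[OF lim, of 0] by simp
  qed
qed

section \<open>Dual modules\<close>

text \<open>The value 0 off \<open>M\<close> follows the convention of \<open>adual\<close>, which
  makes equality of functionals plain equality of functions.\<close>

definition restr :: "'m set \<Rightarrow> ('m \<Rightarrow> 'a::zero) \<Rightarrow> 'm \<Rightarrow> 'a" where
  "restr M s = (\<lambda>x. if x \<in> M then s x else 0)"

theorem theorem2p3:
  fixes scC :: "complex \<Rightarrow> 'a::{real_normed_algebra_1,banach} \<Rightarrow> 'a"
    and st :: "'a \<Rightarrow> 'a"
    and add :: "'n \<Rightarrow> 'n \<Rightarrow> 'n" and z :: 'n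
    and sc :: "complex \<Rightarrow> 'n \<Rightarrow> 'n" and rm :: "'n \<Rightarrow> 'a \<Rightarrow> 'n"
    and ip :: "'n \<Rightarrow> 'n \<Rightarrow> 'a"
    and M :: "'n set"
    and ipM ipN :: "('n \<Rightarrow> 'a) \<Rightarrow> ('n \<Rightarrow> 'a) \<Rightarrow> 'a"
  assumes A: "monotone_complete scC st"
    and N: "hilbert_mod scC st UNIV add z sc rm ip"
    and M: "hilbert_mod scC st M add z sc rm ip"
    and perp: "\<forall>y. (\<forall>x\<in>M. ip x y = 0) \<longrightarrow> y = z"
    and M': "dual_inner scC st M add sc rm ip ipM"
    and N': "dual_inner scC st UNIV add sc rm ip ipN"
  shows "\<exists>\<Phi>.
    (\<forall>r\<in>adual scC M add sc rm ip. \<Phi> r \<in> adual scC UNIV add sc rm ip) \<and>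
    (\<forall>r\<in>adual scC M add sc rm ip. \<forall>s\<in>adual scC M add sc rm ip.
        ipN (\<Phi> r) (\<Phi> s) = ipM r s) \<and>
    (\<forall>r\<in>adual scC M add sc rm ip. \<forall>s\<in>adual scC M add sc rm ip.
        \<Phi> (dadd r s) = dadd (\<Phi> r) (\<Phi> s)) \<and>
    (\<forall>c. \<forall>r\<in>adual scC M add sc rm ip. \<Phi> (dsc scC c r) = dsc scC c (\<Phi> r)) \<and>
    (\<forall>r\<in>adual scC M add sc rm ip. \<forall>a. \<Phi> (drm st r a) = drm st (\<Phi> r) a) \<and>
    (\<forall>x\<in>M. \<Phi> (hat M ip x) = hat UNIV ip x) \<and>
    hilbert_mod scC st (\<Phi> ` adual scC M add sc rm ip) dadd dzero (dsc scC) (drm st) ipN \<and>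
    (\<forall>t\<in>adual scC UNIV add sc rm ip. \<exists>u\<in>\<Phi> ` adual scC M add sc rm ip.
        \<exists>v\<in>adual scC UNIV add sc rm ip. t = dadd u v \<and>
          (\<forall>w\<in>\<Phi> ` adual scC M add sc rm ip. ipN w v = 0))"
proof -

  \<comment> \<open>The two dual modules\<close>
  define DM where "DM = adual scC M add sc rm ip"
  define DN where "DN = adual scC UNIV add sc rm ip"
  interpret A: cstar_algebra scC st
    using A by unfold_locales (simp add: monotone_complete_def)
  have "hilbert_mod scC st DM dadd dzero (dsc scC) (drm st) ipM"
    and evalM: "\<And>r x. \<lbrakk>r \<in> DM; x \<in> M\<rbrakk> \<Longrightarrow> ipM r (hat M ip x) = r x"
    using M' unfolding dual_inner_def Let_def DM_def by blast+
  then interpret DM: hilbert_module scC st DM dadd dzero "dsc scC" "drm st" ipM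
    by unfold_locales
  have "hilbert_mod scC st DN dadd dzero (dsc scC) (drm st) ipN"
    and evalN: "\<And>r x. r \<in> DN \<Longrightarrow> ipN r (hat UNIV ip x) = r x"
    and dualN: "\<And>\<phi>. bdd_alin scC DN dadd (dsc scC) (drm st) ipN \<phi> \<Longrightarrow>
      \<exists>r\<in>DN. \<forall>s\<in>DN. \<phi> s = ipN r s"
    using N' unfolding dual_inner_def Let_def DN_def by blast+
  then interpret DN: hilbert_module scC st DN dadd dzero "dsc scC" "drm st" ipN
    by unfold_locales
  interpret N: hilbert_module scC st UNIV add z sc rm ip
    using N by unfold_locales
  interpret M: hilbert_module scC st M add z sc rm ip
    using M by unfold_locales
  let ?h = "hat M ip"
  \<comment> \<open>Here \<open>y\<close> ranges over all of \<open>N\<close>, not only over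
    \<open>M\<close>: pairing with \<open>y\<close> is a bounded functional on \<open>M\<close> by
    Cauchy-Schwarz.\<close>
  have hat_DM: "?h y \<in> DM" for y
  proof -
    have "norm (?h y x) \<le> mnorm ip y * mnorm ip x" if "x \<in> M" for x
      using that N.norm_ip_le[of y x] by (simp add: hat_def)
    then show ?thesis
      unfolding DM_def adual_def bdd_alin_def
      by (auto simp: hat_def M.closed N.ip_simps)
  qed
  have hat_DN: "hat UNIV ip y \<in> DN" for y
    unfolding DN_def adual_def bdd_alin_def
    using N.norm_ip_le[of y] by (auto simp: hat_def N.ip_simps)

  \<comment> \<open>Restriction of functionals and its boundedness\<close>
  have restr_DM: "restr M s \<in> DM" if "s \<in> DN" for s
    using that unfolding DM_def DN_def adual_def bdd_alin_def
    by (auto simp: restr_def M.closed)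
  have restr_add: "restr M (dadd r s) = dadd (restr M r) (restr M s)" for r s :: "'n \<Rightarrow> 'a"
    by (auto simp: restr_def dadd_def)
  have restr_sc: "restr M (dsc scC c s) = dsc scC c (restr M s)" for c s
    by (auto simp: restr_def dsc_def A.scC_zero_right)
  have restr_rm: "restr M (drm st s a) = drm st (restr M s) a" for s a
    by (auto simp: restr_def drm_def)
  have restr_hat: "restr M (hat UNIV ip y) = ?h y" for y
    by (auto simp: restr_def hat_def)
  obtain K where K: "0 \<le> K" "\<And>s. s \<in> DN \<Longrightarrow> mnorm ipM (restr M s) \<le> K * mnorm ipN s"
  proof (rule closed_graph[of scC st DN dadd dzero "dsc scC" "drm st" ipN
        DM dadd dzero "dsc scC" "drm st" ipM "restr M"])
    fix f :: "nat \<Rightarrow> 'n \<Rightarrow> 'a" and y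
    assume f: "\<And>n. f n \<in> DN" and y: "y \<in> DM"
      and f0: "(\<lambda>n. mnorm ipN (f n)) \<longlonglongrightarrow> 0"
      and fy: "(\<lambda>n. mnorm ipM (dadd (restr M (f n)) (dsc scC (- 1) y))) \<longlonglongrightarrow> 0"
    show "y = dzero"
    proof
      fix x
      show "y x = dzero x"
      proof (cases "x \<in> M")
        case False
        then show ?thesis
          using y by (simp add: DM_def adual_def dzero_def)
      next
        case True
        \<comment> \<open>Evaluation at \<open>x\<close> is pairing with the image of
          \<open>x\<close> in the dual, so Cauchy-Schwarz bounds it by the dual norm.\<close>
        have bd: "norm (f n x) \<le> mnorm ipN (f n) * mnorm ipN (hat UNIV ip x)" for n
          using DN.norm_ip_le[OF f hat_DN, of n x] by (simp add: evalN f)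
        have lim0: "(\<lambda>n. f n x) \<longlonglongrightarrow> 0"
          by (rule Lim_null_comparison[OF always_eventually[OF allI[OF bd]]
              tendsto_mult_left_zero[OF f0]])
        have bd': "norm (f n x - y x)
            \<le> mnorm ipM (dadd (restr M (f n)) (dsc scC (- 1) y)) * mnorm ipM (?h x)" for n
        proof -
          have mem: "dadd (restr M (f n)) (dsc scC (- 1) y) \<in> DM"
            using y by (intro DM.closed restr_DM f)
          have "ipM (dadd (restr M (f n)) (dsc scC (- 1) y)) (?h x) = f n x - y x"
            using True by (simp add: evalM[OF mem]) (simp add: dadd_def restr_def dsc_def A.scC_minus_one)
          then show ?thesis
            using DM.norm_ip_le[OF mem hat_DM[of x]] by simp
        qed
        have "(\<lambda>n. f n x - y x) \<longlonglongrightarrow> 0"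
          by (rule Lim_null_comparison[OF always_eventually[OF allI[OF bd']]
              tendsto_mult_left_zero[OF fy]])
        then have "(\<lambda>n. f n x) \<longlonglongrightarrow> y x"
          by (simp add: LIM_zero_iff)
        then show ?thesis
          using lim0 LIMSEQ_unique by (auto simp: dzero_def)
      qed
    qed
  qed (use DM.hilbert_module_axioms DN.hilbert_module_axioms restr_DM restr_add restr_sc in auto)

  \<comment> \<open>The adjoint of restriction as an isometric embedding\<close>
  define \<Phi> where "\<Phi> r = (\<lambda>y. ipM r (?h y))" for r
  have adjoint: "\<Phi> r \<in> DN \<and> (\<forall>s\<in>DN. ipN (\<Phi> r) s = ipM r (restr M s))" if r: "r \<in> DM" for r
  proof -
    have "norm (ipM r (restr M s)) \<le> (mnorm ipM r * K) * mnorm ipN s" if s: "s \<in> DN" for s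
    proof -
      have "norm (ipM r (restr M s)) \<le> mnorm ipM r * mnorm ipM (restr M s)"
        by (rule DM.norm_ip_le[OF r restr_DM[OF s]])
      also have "\<dots> \<le> mnorm ipM r * (K * mnorm ipN s)"
        by (intro mult_left_mono K s DM.mnorm_nonneg)
      finally show ?thesis
        by (simp add: mult.assoc)
    qed
    then have "bdd_alin scC DN dadd (dsc scC) (drm st) ipN (\<lambda>s. ipM r (restr M s))"
      unfolding bdd_alin_def restr_add restr_sc restr_rm
      using r by (auto simp: DM.ip_simps restr_DM)
    then obtain t where t: "t \<in> DN" "\<And>s. s \<in> DN \<Longrightarrow> ipM r (restr M s) = ipN t s"
      using dualN by blast
    \<comment> \<open>Testing the representing element \<open>t\<close> on
      \<open>hat UNIV ip y\<close> recovers the explicit formula for \<open>\<Phi> r\<close> at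
      \<open>y\<close>.\<close>
    have "\<Phi> r = t"
    proof
      show "\<Phi> r y = t y" for y
        using t(2)[OF hat_DN[of y]] t(1) by (simp add: \<Phi>_def restr_hat evalN)
    qed
    then show ?thesis
      using t by simp
  qed
  then have \<Phi>_DN: "\<And>r. r \<in> DM \<Longrightarrow> \<Phi> r \<in> DN"
    and ip_\<Phi>: "\<And>r s. \<lbrakk>r \<in> DM; s \<in> DN\<rbrakk> \<Longrightarrow> ipN (\<Phi> r) s = ipM r (restr M s)"
    by blast+
  have restr_\<Phi>: "restr M (\<Phi> r) = r" if "r \<in> DM" for r
    using that evalM[OF that] by (auto simp: restr_def \<Phi>_def DM_def adual_def)
  have iso: "ipN (\<Phi> r) (\<Phi> s) = ipM r s" if "r \<in> DM" "s \<in> DM" for r s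
    using that by (simp add: ip_\<Phi> \<Phi>_DN restr_\<Phi>)
  have \<Phi>_add: "\<Phi> (dadd r s) = dadd (\<Phi> r) (\<Phi> s)" if "r \<in> DM" "s \<in> DM" for r s
    using DM.ip_add_left[OF that hat_DM] unfolding \<Phi>_def by (simp add: dadd_def)
  have \<Phi>_sc: "\<Phi> (dsc scC c r) = dsc scC c (\<Phi> r)" if "r \<in> DM" for c r
    using DM.ip_sc_left[OF that hat_DM] unfolding \<Phi>_def by (simp add: dsc_def)
  have \<Phi>_rm: "\<Phi> (drm st r a) = drm st (\<Phi> r) a" if "r \<in> DM" for a r
    using DM.ip_rm_left[OF that hat_DM] unfolding \<Phi>_def by (simp add: drm_def)
  have \<Phi>_hat: "\<Phi> (?h x) = hat UNIV ip x" if x: "x \<in> M" for x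
  proof
    fix y
    \<comment> \<open>The involution moves \<open>?h x\<close> to the right, where
      \<open>evalM\<close> applies since \<open>x\<close> lies in \<open>M\<close>; \<open>y\<close>
      need not.\<close>
    have "\<Phi> (?h x) y = st (ipM (?h y) (?h x))"
      by (simp add: \<Phi>_def DM.star_ip hat_DM)
    also have "\<dots> = st (ip y x)"
      using x by (simp add: evalM hat_DM) (simp add: hat_def)
    finally show "\<Phi> (?h x) y = hat UNIV ip x y"
      by (simp add: hat_def N.star_ip)
  qed
  have \<Phi>_zero: "\<Phi> dzero = dzero"
    using \<Phi>_sc[OF DM.zero_closed, of 0] by (simp add: dsc_def dzero_def A.scC_zero_left)

  \<comment> \<open>The image as a Hilbert submodule\<close>
  have image: "hilbert_mod scC st (\<Phi> ` DM) dadd dzero (dsc scC) (drm st) ipN"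
  proof (rule DN.hilbert_mod_subset)
    show "\<Phi> ` DM \<subseteq> DN"
      using \<Phi>_DN by blast
    show "dzero \<in> \<Phi> ` DM"
      using \<Phi>_zero DM.zero_closed by (metis imageI)
    show "dadd u v \<in> \<Phi> ` DM" if "u \<in> \<Phi> ` DM" "v \<in> \<Phi> ` DM" for u v
      using that \<Phi>_add DM.add_closed by (metis (no_types, lifting) image_iff)
    show "dsc scC c u \<in> \<Phi> ` DM" if "u \<in> \<Phi> ` DM" for c u
      using that \<Phi>_sc DM.sc_closed by (metis (no_types, lifting) image_iff)
    show "drm st u a \<in> \<Phi> ` DM" if "u \<in> \<Phi> ` DM" for a u
      using that \<Phi>_rm DM.rm_closed by (metis (no_types, lifting) image_iff)
    show "\<exists>l\<in>\<Phi> ` DM. (\<lambda>n. mnorm ipN (DN.sub (f n) l)) \<longlonglongrightarrow> 0"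
      if f: "\<And>n. f n \<in> \<Phi> ` DM"
        and cau: "\<And>e. 0 < e \<Longrightarrow> \<exists>K. \<forall>m n. K \<le> m \<and> K \<le> n \<longrightarrow> mnorm ipN (DN.sub (f m) (f n)) < e"
      for f :: "nat \<Rightarrow> 'n \<Rightarrow> 'a"
    proof -
      \<comment> \<open>Completeness is pulled back along the isometry: preimages of a Cauchy
        sequence are Cauchy in \<open>DM\<close>.\<close>
      define g where "g n = inv_into DM \<Phi> (f n)" for n
      have g: "g n \<in> DM" "f n = \<Phi> (g n)" for n
        using f[of n] by (simp_all add: g_def inv_into_into f_inv_into_f)
      have eq: "mnorm ipN (DN.sub (\<Phi> r) (\<Phi> s)) = mnorm ipM (DM.sub r s)"
        if "r \<in> DM" "s \<in> DM" for r s
      proof -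
        have "DN.sub (\<Phi> r) (\<Phi> s) = \<Phi> (DM.sub r s)"
          using that by (simp add: DM.sub_def DN.sub_def \<Phi>_add \<Phi>_sc DM.closed)
        then show ?thesis
          using that by (simp add: mnorm_def iso DM.closed)
      qed
      have "\<exists>K. \<forall>m n. K \<le> m \<and> K \<le> n \<longrightarrow> mnorm ipM (DM.sub (g m) (g n)) < e" if "0 < e" for e
        using cau[OF that] by (simp only: g(2) eq[OF g(1) g(1)])
      then obtain l where l: "l \<in> DM" "(\<lambda>n. mnorm ipM (DM.sub (g n) l)) \<longlonglongrightarrow> 0"
        using DM.complete[of g] g(1) by metis
      then show ?thesis
        by (intro bexI[of _ "\<Phi> l"]) (simp_all add: g(2) eq g(1))
    qed
  qed

  \<comment> \<open>Orthogonal decomposition of the larger dual\<close>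
  have summand: "\<exists>u\<in>\<Phi> ` DM. \<exists>v\<in>DN. t = dadd u v \<and> (\<forall>w\<in>\<Phi> ` DM. ipN w v = 0)" if t: "t \<in> DN" for t
  proof (intro bexI conjI ballI)
    let ?u = "\<Phi> (restr M t)"
    show "?u \<in> \<Phi> ` DM"
      using restr_DM[OF t] by simp
    show "DN.sub t ?u \<in> DN"
      using t by (intro DN.closed \<Phi>_DN restr_DM)
    show "t = dadd ?u (DN.sub t ?u)"
      by (auto simp: DN.sub_def dadd_def dsc_def A.scC_minus_one)
    fix w
    assume "w \<in> \<Phi> ` DM"
    then obtain r where r: "r \<in> DM" "w = \<Phi> r"
      by blast
    \<comment> \<open>By adjointness the pairing is that of \<open>r\<close> with the restriction of
      \<open>t - ?u\<close>, and \<open>?u\<close> restricts to the same functional as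
      \<open>t\<close>.\<close>
    then show "ipN w (DN.sub t ?u) = 0"
      using t by (simp add: DN.ip_sub_right \<Phi>_DN restr_DM ip_\<Phi> restr_\<Phi>)
  qed
  show ?thesis
    unfolding DM_def[symmetric] DN_def[symmetric]
    using \<Phi>_DN iso \<Phi>_add \<Phi>_sc \<Phi>_rm \<Phi>_hat image summand
    by (intro exI[of _ \<Phi>] conjI ballI allI) simp_all
qed

end
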